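(* Consider discrete bidding play of the game $TTT$ (Tic-Tac-Toe in which Bob is declared the winner of any game that would normally be a tie), starting from the empty board, with total number of ordinary chips $k\ge 0$. (1) Moving in the center square is an optimal first move for Alice if and only if $k\neq 5$. (2) Moving in a corner square is an optimal first move for Alice if and only if $k\in\{0,1,2,3,4,5,6,7,9,11,12,13,14,19,20,22,26\}$.
   Context: $TTT$: on a $3\times 3$ board, initially empty, a move by Alice (Bob) places her (his) mark in an empty square. The first player to have three of their own marks in a row, column or diagonal wins; a full board with no such line counts as a win for Bob. The players do not alternate; bidding determines who makes each move. Discrete bidding: Alice and Bob hold nonnegative integer numbers of identical chips, $k$ in total, and exactly one of them holds the tie-breaking advantage $*$. Before each move both simultaneously bid a nonnegative integer not exceeding their own number of chips. The winner of the bid gives the amount of the winning bid to the other player and decides which player makes the next move. The higher bid wins; if the bids are tied, the holder of the tie-breaking advantage either declares the other player the winner of the bid and keeps the advantage, or declares himself the winner of the bid and gives the advantage to the other player. A player's chip count is an element of $\mathbb{N}\cup\mathbb{N}^*$: $a$ means $a$ chips without the tie-breaking advantage, $a^*$ means $a$ chips with it; the order is $0<0^*<1<1^*<2<\cdots$. For a fixed total $k$, let $f(TTT,k)$ be the threshold such that Alice has a winning strategy if and only if her initial chip count is at least $f(TTT,k)$ (with value $k+1$ if she never wins). For a given kind of first move (center, corner), consider the analogous threshold when Alice is required to make that move in case she makes the first move of the game (all other decisions of both players being unrestricted). The first move is called optimal for Alice, for total $k$, if this restricted threshold equals $f(TTT,k)$. *)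

theory Defs
  imports Main
begin

section \<open>The board\<close>

datatype player = Alice | Bob

fun opponent :: "player \<Rightarrow> player" where
  "opponent Alice = Bob"
| "opponent Bob = Alice"

type_synonym square = "nat \<times> nat"

type_synonym board = "square \<Rightarrow> player option"

definition squares :: "square set" where
  "squares = {0, 1, 2} \<times> {0, 1, 2}"

definition center :: square where
  "center = (1, 1)"

definition corners :: "square set" where
  "corners = {0, 2} \<times> {0, 2}"

definition lines :: "square set set" where
  "lines = {{i} \<times> {0, 1, 2} |i. i \<in> {0, 1, 2}} \<union> {{0, 1, 2} \<times> {j} |j. j \<in> {0, 1, 2}}
     \<union> {{(0, 0), (1, 1), (2, 2)}, {(0, 2), (1, 1), (2, 0)}}"

definition has_line :: "board \<Rightarrow> player \<Rightarrow> bool" where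
  "has_line B p \<longleftrightarrow> (\<exists>l\<in>lines. \<forall>q\<in>l. B q = Some p)"

definition game_over :: "board \<Rightarrow> bool" where
  "game_over B \<longleftrightarrow> has_line B Alice \<or> has_line B Bob \<or> (\<forall>q\<in>squares. B q \<noteq> None)"

section \<open>Discrete bidding play\<close>

record state =
  board :: board
  chips :: "player \<Rightarrow> nat"
  holder :: player  \<comment> \<open>the holder of the tie-breaking advantage\<close>

text \<open>One round consists of both bids, the player who is (or, after a tie, is declared by the holder
  to be) the winner of the bid, the player chosen by that winner to move, and the square which the
  latter then marks.\<close>

record round =
  bids :: "player \<Rightarrow> nat"
  bid_winner :: player
  mover :: player
  target :: square

definition tied :: "(player \<Rightarrow> nat) \<Rightarrow> bool" where
  "tied b \<longleftrightarrow> b Alice = b Bob"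

definition legal_round :: "state \<Rightarrow> round \<Rightarrow> bool" where
  "legal_round s r \<longleftrightarrow>
     (\<forall>p. bids r p \<le> chips s p) \<and>
     bids r (opponent (bid_winner r)) \<le> bids r (bid_winner r) \<and>
     target r \<in> squares \<and> board s (target r) = None"

definition next_state :: "state \<Rightarrow> round \<Rightarrow> state" where
  "next_state s r =
     \<lparr>board = (board s)(target r := Some (mover r)),
      chips = (\<lambda>p. if p = bid_winner r then chips s p - bids r (bid_winner r)
                   else chips s p + bids r (bid_winner r)),
      holder = (if tied (bids r) \<and> bid_winner r = holder s then opponent (holder s)
                else holder s)\<rparr>"

definition state_after :: "state \<Rightarrow> round list \<Rightarrow> state" where
  "state_after s h = foldl next_state s h"

text \<open>Histories list the rounds in chronological order; no round is played after the end of the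
  game.\<close>

definition legal_history :: "state \<Rightarrow> round list \<Rightarrow> bool" where
  "legal_history s h \<longleftrightarrow>
     (\<forall>i<length h. \<not> game_over (board (state_after s (take i h))) \<and>
                   legal_round (state_after s (take i h)) (h ! i))"

section \<open>Strategies for Alice\<close>

text \<open>Every decision may depend on all previous rounds and on what has happened so far in the
  current round: the bid only on the history (bids are simultaneous), the later decisions also on
  both bids, and the choice of a square also on who won the bid.\<close>

record strategy =
  bid :: "round list \<Rightarrow> nat"
  declare_winner :: "round list \<Rightarrow> (player \<Rightarrow> nat) \<Rightarrow> player"
  choose_mover :: "round list \<Rightarrow> (player \<Rightarrow> nat) \<Rightarrow> player"
  choose_square :: "round list \<Rightarrow> (player \<Rightarrow> nat) \<Rightarrow> player \<Rightarrow> square"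

definition legal_strategy :: "state \<Rightarrow> strategy \<Rightarrow> bool" where
  "legal_strategy s \<sigma> \<longleftrightarrow>
     (\<forall>h. legal_history s h \<and> \<not> game_over (board (state_after s h)) \<longrightarrow>
        bid \<sigma> h \<le> chips (state_after s h) Alice \<and>
        (\<forall>b w. choose_square \<sigma> h b w \<in> squares \<and>
               board (state_after s h) (choose_square \<sigma> h b w) = None))"

text \<open>Here \<open>h\<close> is the history and \<open>t\<close> the state before the round \<open>r\<close>.\<close>

definition follows_round :: "strategy \<Rightarrow> round list \<Rightarrow> state \<Rightarrow> round \<Rightarrow> bool" where
  "follows_round \<sigma> h t r \<longleftrightarrow>
     bids r Alice = bid \<sigma> h \<and>
     (tied (bids r) \<and> holder t = Alice \<longrightarrow> bid_winner r = declare_winner \<sigma> h (bids r)) \<and>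
     (bid_winner r = Alice \<longrightarrow> mover r = choose_mover \<sigma> h (bids r)) \<and>
     (mover r = Alice \<longrightarrow> target r = choose_square \<sigma> h (bids r) (bid_winner r))"

definition follows :: "strategy \<Rightarrow> state \<Rightarrow> round list \<Rightarrow> bool" where
  "follows \<sigma> s h \<longleftrightarrow>
     (\<forall>i<length h. follows_round \<sigma> (take i h) (state_after s (take i h)) (h ! i))"

text \<open>A finished game without a line of Alice's marks is a win for Bob, in particular if the board
  is full. Every game ends after at most nine rounds.\<close>

definition winning_strategy :: "state \<Rightarrow> strategy \<Rightarrow> bool" where
  "winning_strategy s \<sigma> \<longleftrightarrow>
     legal_strategy s \<sigma> \<and>
     (\<forall>h. legal_history s h \<and> follows \<sigma> s h \<and> game_over (board (state_after s h)) \<longrightarrow>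
        has_line (board (state_after s h)) Alice)"

section \<open>Chip counts and thresholds\<close>

text \<open>\<open>Plain a\<close> is \<open>a\<close> chips without and \<open>Starred a\<close> is \<open>a\<close> chips with the tie-breaking advantage.\<close>

datatype chip_count = Plain (amount: nat) | Starred (amount: nat)

fun rank :: "chip_count \<Rightarrow> nat" where
  "rank (Plain a) = 2 * a"
| "rank (Starred a) = 2 * a + 1"

lemma rank_inject: "rank c = rank d \<Longrightarrow> c = d"
  by (cases c; cases d) (auto, presburger+)

instantiation chip_count :: linorder
begin

definition less_eq_chip_count :: "chip_count \<Rightarrow> chip_count \<Rightarrow> bool" where
  "c \<le> d \<longleftrightarrow> rank c \<le> rank d"

definition less_chip_count :: "chip_count \<Rightarrow> chip_count \<Rightarrow> bool" where
  "c < d \<longleftrightarrow> rank c < rank d"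

instance
  by standard (auto simp: less_eq_chip_count_def less_chip_count_def intro: rank_inject)

end

text \<open>The empty board, with \<open>k\<close> chips in total, of which Alice has \<open>c\<close>.\<close>

definition initial_state :: "nat \<Rightarrow> chip_count \<Rightarrow> state" where
  "initial_state k c =
     \<lparr>board = (\<lambda>q. None),
      chips = (\<lambda>p. case p of Alice \<Rightarrow> amount c | Bob \<Rightarrow> k - amount c),
      holder = (case c of Plain a \<Rightarrow> Bob | Starred a \<Rightarrow> Alice)\<rparr>"

definition alice_wins :: "nat \<Rightarrow> chip_count \<Rightarrow> bool" where
  "alice_wins k c \<longleftrightarrow> (\<exists>\<sigma>. winning_strategy (initial_state k c) \<sigma>)"

text \<open>Alice has to mark a square of \<open>S\<close> if she makes the first move of the game.\<close>

definition alice_wins_opening :: "square set \<Rightarrow> nat \<Rightarrow> chip_count \<Rightarrow> bool" where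
  "alice_wins_opening S k c \<longleftrightarrow>
     (\<exists>\<sigma>. winning_strategy (initial_state k c) \<sigma> \<and> (\<forall>b w. choose_square \<sigma> [] b w \<in> S))"

text \<open>\<open>Plain (k + 1)\<close>, the successor of \<open>Starred k\<close>, is the threshold if no count
  with at most \<open>k\<close> chips satisfies \<open>W\<close>.\<close>

definition is_threshold :: "nat \<Rightarrow> (chip_count \<Rightarrow> bool) \<Rightarrow> chip_count \<Rightarrow> bool" where
  "is_threshold k W t \<longleftrightarrow> t \<le> Plain (k + 1) \<and> (\<forall>c. amount c \<le> k \<longrightarrow> (W c \<longleftrightarrow> t \<le> c))"

lemma is_threshold_unique:
  assumes "is_threshold k W t" "is_threshold k W u"
  shows "t = u"
proof -
  have not_less: "\<not> x < y" if x: "is_threshold k W x" and y: "is_threshold k W y" for x y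
  proof
    assume "x < y"
    with y have "x < Plain (k + 1)"
      by (auto simp: is_threshold_def)
    then have "amount x \<le> k"
      by (cases x) (auto simp: less_chip_count_def)
    with x y have "y \<le> x"
      by (auto simp: is_threshold_def)
    with \<open>x < y\<close> show False
      by simp
  qed
  show ?thesis
    using not_less[OF assms] not_less[OF assms(2,1)] by (simp add: not_less)
qed

definition f_TTT :: "nat \<Rightarrow> chip_count" where
  "f_TTT k = (THE t. is_threshold k (alice_wins k) t)"

definition f_TTT_opening :: "square set \<Rightarrow> nat \<Rightarrow> chip_count" where
  "f_TTT_opening S k = (THE t. is_threshold k (alice_wins_opening S k) t)"

definition optimal_first_move :: "square set \<Rightarrow> nat \<Rightarrow> bool" where
  "optimal_first_move S k \<longleftrightarrow> f_TTT_opening S k = f_TTT k"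

end

theory Submission
  imports Defs
begin

text \<open>
  A count of Alice is identified with its rank, so that the counts with \<open>k\<close> chips are the numbers below
  \<open>2 * K\<close> with \<open>K = k + 1\<close>. If \<open>a\<close> and \<open>b\<close> are the thresholds after the best move of Alice and of
  Bob, then the threshold of a position is \<open>\<lceil>a / 2\<rceil> + \<lfloor>b / 2\<rfloor>\<close>; an additional mark never hurts its owner,
  so letting the opponent move is pointless and \<open>a \<le> b\<close>. Hence a first move is optimal iff its
  \<open>\<lceil>a / 2\<rceil>\<close> is least possible.

  The thresholds which matter, as functions of \<open>K\<close>, arise from \<open>0\<close> and \<open>2 * K\<close> by iterating the mean
  above, and all of them satisfy \<open>f (K + 64) = f K + f 64\<close>. So inequalities between them reduce to finitely
  many values of \<open>K\<close>. A strategy of Alice (Bob) that does not depend on \<open>K\<close> yields upper (lower) bounds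
  of this form; such strategies, written as tables of positions up to symmetry, determine the threshold
  after the center exactly and bound those after a corner and an edge well enough.
\<close>

section \<open>Values of positions\<close>

text \<open>The rounding in \<open>mean\<close> comes from the tie-breaking advantage. If Alice has
  \<open>m\<close> chips without it, a bid \<open>x\<close> must leave
  \<open>2 * (m - x) \<ge> a\<close> when she wins, and \<open>2 * (m + x) + 1 \<ge> b\<close> when
  Bob wins a tie and hands over the advantage. So \<open>m - x\<close> is at least
  \<open>a / 2\<close> rounded up and \<open>m + x\<close> at least \<open>b / 2\<close> rounded
  down; for \<open>a \<le> b\<close> such an \<open>x\<close> exists iff the rank
  \<open>2 * m\<close> is at least \<open>mean a b\<close>. If Alice holds the advantage, the parity
  of \<open>a\<close> decides what she does with a tie. Without rounding all values would be
  proportional to \<open>K\<close>, and the center would always be strictly best. Rounding shifts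
  values by a bounded amount, while the lead of the center grows with \<open>K\<close>; so all
  exceptions are small, but estimates up to a constant cannot find them and exact values are
  required.\<close>

declare split_paired_All [simp del] split_paired_Ex [simp del]

definition mean :: "nat \<Rightarrow> nat \<Rightarrow> nat" where
  "mean x y = (x + 1) div 2 + y div 2"

lemma mean_mono: "x \<le> x' \<Longrightarrow> y \<le> y' \<Longrightarrow> mean x y \<le> mean x' y'"
  by (auto simp: mean_def intro!: add_mono div_le_mono)

definition empties :: "board \<Rightarrow> square set" where
  "empties B = {q \<in> squares. B q = None}"

definition place :: "player \<Rightarrow> board \<Rightarrow> square \<Rightarrow> board" where
  "place p B q = B(q := Some p)"

lemma finite_squares [simp]: "finite squares"
  by (simp add: squares_def)

lemma finite_empties [simp]: "finite (empties B)"
  by (simp add: empties_def)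

lemma empties_place: "empties (place p B q) = empties B - {q}"
  by (auto simp: empties_def place_def)

lemma card_empties_place [simp]:
  "q \<in> empties B \<Longrightarrow> card (empties (place p B q)) < card (empties B)"
  unfolding empties_place by (rule card_Diff1_less[OF finite_empties])

text \<open>With \<open>K = k + 1\<close> the value \<open>2 * K\<close> of a lost position exceeds
  \<open>2 * k + 1\<close>, the rank of the largest count. Arbitrary boards get a value, even those
  with lines of both players, so the order of the tests matters.\<close>

function val :: "nat \<Rightarrow> board \<Rightarrow> nat" where
  "val K B =
     (if has_line B Alice then 0
      else if has_line B Bob \<or> empties B = {} then 2 * K
      else mean (Min ((\<lambda>q. val K (place Alice B q)) ` empties B))
                (Max ((\<lambda>q. val K (place Bob B q)) ` empties B)))"
  by auto
termination
  by (relation "measure (\<lambda>(K, B). card (empties B))") auto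

declare val.simps [simp del]

text \<open>The set \<open>S\<close> is there for the prescribed first move; Bob is never
  restricted, so \<open>hi\<close> has no such parameter.\<close>

definition lo :: "nat \<Rightarrow> square set \<Rightarrow> board \<Rightarrow> nat" where
  "lo K S B = Min ((\<lambda>q. val K (place Alice B q)) ` (S \<inter> empties B))"

definition hi :: "nat \<Rightarrow> board \<Rightarrow> nat" where
  "hi K B = Max ((\<lambda>q. val K (place Bob B q)) ` empties B)"

lemma squares_Int_empties [simp]: "squares \<inter> empties B = empties B"
  by (auto simp: empties_def)

lemma game_over_iff: "game_over B \<longleftrightarrow> has_line B Alice \<or> has_line B Bob \<or> empties B = {}"
  by (auto simp: game_over_def empties_def)

lemma val_running: "\<not> game_over B \<Longrightarrow> val K B = mean (lo K squares B) (hi K B)"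
  by (subst val.simps) (auto simp: game_over_iff lo_def hi_def)

lemma val_Alice: "has_line B Alice \<Longrightarrow> val K B = 0"
  by (simp add: val.simps)

lemma val_Bob: "game_over B \<Longrightarrow> \<not> has_line B Alice \<Longrightarrow> val K B = 2 * K"
  by (auto simp: val.simps game_over_iff)

lemma lo_le: "q \<in> S \<inter> empties B \<Longrightarrow> lo K S B \<le> val K (place Alice B q)"
  by (auto simp: lo_def)

lemma lo_attained:
  assumes "S \<inter> empties B \<noteq> {}"
  obtains q where "q \<in> S \<inter> empties B" "val K (place Alice B q) = lo K S B"
proof -
  have "lo K S B \<in> (\<lambda>q. val K (place Alice B q)) ` (S \<inter> empties B)"
    unfolding lo_def using assms by (intro Min_in) auto
  then show ?thesis using that by auto
qed

lemma hi_ge: "q \<in> empties B \<Longrightarrow> val K (place Bob B q) \<le> hi K B"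
  by (auto simp: hi_def)

lemma hi_attained:
  assumes "empties B \<noteq> {}"
  obtains q where "q \<in> empties B" "val K (place Bob B q) = hi K B"
proof -
  have "hi K B \<in> (\<lambda>q. val K (place Bob B q)) ` empties B"
    unfolding hi_def using assms by (intro Max_in) auto
  then show ?thesis using that by auto
qed

lemma val_le: "val K B \<le> 2 * K"
proof (induction K B rule: val.induct)
  case (1 K B)
  show ?case
  proof (cases "game_over B")
    case True
    then show ?thesis by (cases "has_line B Alice") (auto simp: val_Alice val_Bob)
  next
    case False
    then have ne: "squares \<inter> empties B \<noteq> {}" "empties B \<noteq> {}" by (auto simp: game_over_iff)
    obtain q where "q \<in> empties B" "val K (place Alice B q) = lo K squares B"
      using lo_attained[OF ne(1)] by auto
    moreover obtain q' where "q' \<in> empties B" "val K (place Bob B q') = hi K B"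
      by (rule hi_attained[OF ne(2)])
    ultimately have "lo K squares B \<le> 2 * K" "hi K B \<le> 2 * K"
      using 1 False by (metis game_over_iff)+
    then have "mean (lo K squares B) (hi K B) \<le> mean (2 * K) (2 * K)"
      by (rule mean_mono)
    then show ?thesis using False by (simp add: val_running mean_def)
  qed
qed

section \<open>Monotonicity of values in the marks\<close>

definition better :: "board \<Rightarrow> board \<Rightarrow> bool" where
  "better B C \<longleftrightarrow> (\<forall>q. B q = C q \<or> B q = Some Alice \<or> C q = Some Bob)"

lemma betterD: "better B C \<Longrightarrow> B q = C q \<or> B q = Some Alice \<or> C q = Some Bob"
  by (simp add: better_def)

lemma better_line_Alice: "better B C \<Longrightarrow> has_line C Alice \<Longrightarrow> has_line B Alice"
  unfolding has_line_def better_def by (metis option.inject player.distinct(1))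

lemma better_line_Bob: "better B C \<Longrightarrow> has_line B Bob \<Longrightarrow> has_line C Bob"
  unfolding has_line_def better_def by (metis option.inject player.distinct(1))

text \<open>Copying the move fails only if its square is taken in \<open>B\<close>, and then by
  Alice herself; she can waste the turn on any empty square because an extra mark of hers does no
  harm.\<close>

lemma better_Alice_move:
  assumes le: "better B C" and q: "q \<in> empties C" and ne: "empties B \<noteq> {}"
  shows "\<exists>q'\<in>empties B. better (place Alice B q') (place Alice C q)"
proof (cases "q \<in> empties B")
  case True
  then show ?thesis using le by (intro bexI[of _ q]) (auto simp: better_def place_def)
next
  case False
  then have "B q = Some Alice" using betterD[OF le, of q] q by (auto simp: empties_def)
  moreover obtain r where "r \<in> empties B" using ne by blast
  ultimately show ?thesis using le by (intro bexI[of _ r]) (auto simp: better_def place_def)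
qed

lemma better_Bob_move:
  assumes le: "better B C" and q: "q \<in> empties B" and ne: "empties C \<noteq> {}"
  shows "\<exists>q'\<in>empties C. better (place Bob B q) (place Bob C q')"
proof (cases "q \<in> empties C")
  case True
  then show ?thesis using le by (intro bexI[of _ q]) (auto simp: better_def place_def)
next
  case False
  then have "C q = Some Bob" using betterD[OF le, of q] q by (auto simp: empties_def)
  moreover obtain r where "r \<in> empties C" using ne by blast
  ultimately show ?thesis using le by (intro bexI[of _ r]) (auto simp: better_def place_def)
qed

text \<open>Each move on one board is answered on the other so that the relation persists. The two
  boards may have different numbers of empty squares, so the induction is on the sum.\<close>

lemma val_mono: "better B C \<Longrightarrow> val K B \<le> val K C"
proof (induction "card (empties B) + card (empties C)" arbitrary: B C rule: less_induct)
  case less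
  note IH = less.hyps and le = less.prems
  consider "has_line B Alice" | "\<not> has_line C Alice" "game_over C"
    | "\<not> has_line B Alice" "\<not> has_line C Alice" "\<not> game_over C"
    using better_line_Alice[OF le] by blast
  then show ?case
  proof cases
    case 1
    then show ?thesis by (simp add: val_Alice)
  next
    case 2
    then show ?thesis using val_le by (simp add: val_Bob)
  next
    case 3
    then have C: "\<not> has_line C Bob" "empties C \<noteq> {}" by (auto simp: game_over_iff)
    have nB: "\<not> has_line B Bob" using better_line_Bob[OF le] C by blast
    show ?thesis
    proof (cases "empties B = {}")
      case True
      \<comment> \<open>Every empty square of \<open>C\<close> bears Alice's mark in the full board
        \<open>B\<close>, so \<open>B\<close> stays better whoever fills it in
        \<open>C\<close>.\<close>
      have sum: "val K B \<le> val K (place p C q)" if q: "q \<in> empties C" for p q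
      proof (rule IH)
        show "card (empties B) + card (empties (place p C q)) < card (empties B) + card (empties C)"
          using q by simp
        have "q \<notin> empties B" using True by simp
        then have "B q \<noteq> None" using q unfolding empties_def by simp
        then have "B q = Some Alice" using betterD[OF le, of q] q by (auto simp: empties_def)
        then show "better B (place p C q)" using le by (auto simp: better_def place_def)
      qed
      obtain q where "q \<in> empties C" "val K (place Alice C q) = lo K squares C"
        by (rule lo_attained[of squares C K]) (use C in simp_all)
      moreover obtain q' where "q' \<in> empties C" "val K (place Bob C q') = hi K C"
        by (rule hi_attained[OF C(2)])
      ultimately have "val K B \<le> lo K squares C" "val K B \<le> hi K C" using sum by metis+
      then have "mean (val K B) (val K B) \<le> mean (lo K squares C) (hi K C)" by (rule mean_mono)
      then show ?thesis using 3 by (simp add: val_running mean_def)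
    next
      case False
      have runB: "\<not> game_over B" using 3 nB False by (auto simp: game_over_iff)
      have "lo K squares B \<le> lo K squares C"
      proof -
        obtain q where q: "q \<in> empties C" "val K (place Alice C q) = lo K squares C"
          by (rule lo_attained[of squares C K]) (use C in simp_all)
        obtain q' where q': "q' \<in> empties B" "better (place Alice B q') (place Alice C q)"
          using better_Alice_move[OF le q(1) False] by blast
        have "card (empties (place Alice B q')) + card (empties (place Alice C q))
              < card (empties B) + card (empties C)"
          using q(1) q'(1) by (intro add_strict_mono card_empties_place)
        from IH[OF this q'(2)]
        have "val K (place Alice B q') \<le> val K (place Alice C q)" .
        then show ?thesis using lo_le[of q' squares B K] q q' by simp
      qed
      moreover have "hi K B \<le> hi K C"
      proof -
        obtain q where q: "q \<in> empties B" "val K (place Bob B q) = hi K B"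
          by (rule hi_attained[OF False])
        obtain q' where q': "q' \<in> empties C" "better (place Bob B q) (place Bob C q')"
          using better_Bob_move[OF le q(1) C(2)] by blast
        have "card (empties (place Bob B q)) + card (empties (place Bob C q'))
              < card (empties B) + card (empties C)"
          using q(1) q'(1) by (intro add_strict_mono card_empties_place)
        from IH[OF this q'(2)]
        have "val K (place Bob B q) \<le> val K (place Bob C q')" .
        then show ?thesis using hi_ge[of q' C K] q q' by simp
      qed
      ultimately show ?thesis using 3 runB by (simp add: val_running mean_mono)
    qed
  qed
qed

text \<open>On one and the same square a mark of Alice is no worse for her than one of Bob. Hence
  nobody gains by handing over the move, and the bidding lemmas may assume
  \<open>a \<le> b\<close>.\<close>

lemma lo_le_hi:
  assumes "S \<inter> empties B \<noteq> {}"
  shows "lo K S B \<le> hi K B"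
proof -
  obtain q where q: "q \<in> S \<inter> empties B" using assms by auto
  have "better (place Alice B q) (place Bob B q)" by (auto simp: better_def place_def)
  then have "val K (place Alice B q) \<le> val K (place Bob B q)" by (rule val_mono)
  then show ?thesis using lo_le[of q S B K] hi_ge[of q B K] q by auto
qed

section \<open>Optimal bidding\<close>

definition state_rank :: "state \<Rightarrow> nat" where
  "state_rank s = 2 * chips s Alice + (if holder s = Alice then 1 else 0)"

definition total :: "state \<Rightarrow> nat" where
  "total s = chips s Alice + chips s Bob"

definition allowed :: "square set \<Rightarrow> round list \<Rightarrow> square set" where
  "allowed S h = (if h = [] then S else squares)"

lemma ex_player: "(\<forall>p. P p) \<longleftrightarrow> P Alice \<and> P Bob"
  by (metis player.exhaust)

lemma total_next: "legal_round s r \<Longrightarrow> total (next_state s r) = total s"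
  by (cases "bid_winner r") (auto simp: total_def legal_round_def next_state_def ex_player)

lemma board_next: "board (next_state s r) = place (mover r) (board s) (target r)"
  by (simp add: next_state_def place_def)

lemma state_after_Nil: "state_after s [] = s"
  by (simp add: state_after_def)

lemma state_after_snoc: "state_after s (h @ [r]) = next_state (state_after s h) r"
  by (simp add: state_after_def)

lemma legal_history_Nil: "legal_history s []"
  by (simp add: legal_history_def)

lemma legal_history_snoc:
  "legal_history s (h @ [r]) \<longleftrightarrow>
     legal_history s h \<and> \<not> game_over (board (state_after s h)) \<and> legal_round (state_after s h) r"
  by (auto simp: legal_history_def less_Suc_eq nth_append)

lemma follows_Nil: "follows \<sigma> s []"
  by (simp add: follows_def)

lemma follows_snoc:
  "follows \<sigma> s (h @ [r]) \<longleftrightarrow> follows \<sigma> s h \<and> follows_round \<sigma> h (state_after s h) r"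
  by (auto simp: follows_def less_Suc_eq nth_append)

lemma total_state_after: "legal_history s h \<Longrightarrow> total (state_after s h) = total s"
  by (induction h rule: rev_induct)
    (auto simp: state_after_Nil state_after_snoc legal_history_snoc total_next)

lemma target_empty: "legal_round s r \<Longrightarrow> target r \<in> empties (board s)"
  by (auto simp: legal_round_def empties_def)

text \<open>Alice's bid \<open>x\<close> leaves her with \<open>a\<close>, up to rounding, if she wins; a tie goes to her iff \<open>a\<close> is even.\<close>

lemma Alice_bid:
  fixes a b m e x :: nat
  assumes "mean a b \<le> 2 * m + e" "a \<le> b" "e \<le> 1"
    and x: "x = m - (if e = 1 then a div 2 else (a + 1) div 2)"
  shows "even a \<or> e = 0 \<Longrightarrow> a \<le> 2 * (m - x)"
    and "a \<le> 2 * (m - x) + e"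
    and "odd a \<or> e = 0 \<Longrightarrow> b \<le> 2 * (m + x) + 1"
    and "b \<le> 2 * (m + x + 1) + e"
proof -
  define c r d s where "c = a div 2" and "r = a mod 2" and "d = b div 2" and "s = b mod 2"
  have a: "a = 2 * c + r" and b: "b = 2 * d + s" and rs: "r = 0 \<or> r = 1" "s = 0 \<or> s = 1"
    by (auto simp: c_def r_def d_def s_def)
  have halves: "a div 2 = c" "(a + 1) div 2 = c + r" "b div 2 = d" "even a \<longleftrightarrow> r = 0"
    using rs by (auto simp: a b)
  have e: "e = 0 \<or> e = 1" using assms(3) by auto
  have m: "c + r + d \<le> 2 * m + e" "2 * c + r \<le> 2 * d + s"
    using assms(1,2) unfolding mean_def halves by (simp_all add: a b)
  \<comment> \<open>The subtraction defining \<open>x\<close> is exact: \<open>a \<le> b\<close> and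
    the bound on the mean force the subtrahend to be at most \<open>m\<close>.\<close>
  have "x + (if e = 1 then c else c + r) = m"
    unfolding x halves using m rs e by auto
  then obtain "m = x + (if e = 1 then c else c + r)" by simp
  then show "even a \<or> e = 0 \<Longrightarrow> a \<le> 2 * (m - x)"
    "a \<le> 2 * (m - x) + e"
    "odd a \<or> e = 0 \<Longrightarrow> b \<le> 2 * (m + x) + 1"
    "b \<le> 2 * (m + x + 1) + e"
    using m rs e unfolding halves by (auto simp: a b)
qed

text \<open>The inductive step for Alice's strategy. Leaving \<open>a\<close> arbitrary covers the
  restricted first round as well as later ones. The four bounds of \<open>Alice_bid\<close> answer a
  tie won, a bid won outright, a tie lost and a bid lost outright.\<close>

lemma val_after_Alice_round:
  assumes bid: "bids r Alice = chips t Alice - (if holder t = Alice then a div 2 else (a + 1) div 2)"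
    and tie: "tied (bids r) \<and> holder t = Alice \<longrightarrow> bid_winner r = (if even a then Alice else Bob)"
    and mover: "bid_winner r = Alice \<longrightarrow> mover r = Alice"
    and target: "mover r = Alice \<longrightarrow> val K (place Alice (board t) (target r)) = a"
    and legal: "legal_round t r"
    and a: "a \<le> hi K (board t)" and state_rank: "mean a (hi K (board t)) \<le> state_rank t"
  shows "val K (board (next_state t r)) \<le> state_rank (next_state t r)"
proof -
  define m x y where "m = chips t Alice" and "x = bids r Alice" and "y = bids r Bob"
  define b where "b = hi K (board t)"
  define e where "e = (if holder t = Alice then 1 else 0 :: nat)"
  have ab: "a \<le> b" and mean: "mean a b \<le> 2 * m + e" and e: "e \<le> 1"
    using a state_rank by (simp_all add: b_def m_def e_def state_rank_def)
  have x: "x = m - (if e = 1 then a div 2 else (a + 1) div 2)"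
    using bid by (simp add: m_def x_def e_def)
  note bounds = Alice_bid[OF mean ab e x]
  \<comment> \<open>If Bob wins the bid but makes Alice move, she reaches \<open>a\<close>, which is
    at most \<open>b\<close>.\<close>
  have val: "val K (board (next_state t r)) \<le> (if bid_winner r = Alice then a else b)"
  proof (cases "mover r")
    case Alice
    then show ?thesis using target ab by (simp add: board_next)
  next
    case Bob
    then have "bid_winner r \<noteq> Alice" using mover by auto
    then show ?thesis
      using hi_ge[OF target_empty[OF legal], of K] Bob by (simp add: board_next b_def)
  qed
  show ?thesis
  proof (cases "bid_winner r")
    case Alice
    have "y \<le> x" using legal Alice by (simp add: legal_round_def x_def y_def)
    have state_rank': "state_rank (next_state t r) = 2 * (m - x) + (if x = y then 0 else e)"
      using Alice by (cases "holder t") (auto simp: state_rank_def next_state_def m_def x_def y_def e_def tied_def)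
    have "even a \<or> e = 0" if "x = y"
      using tie that Alice by (auto simp: tied_def x_def y_def e_def split: if_splits)
    then have "a \<le> state_rank (next_state t r)"
      using state_rank' bounds(1,2) by (cases "x = y") auto
    then show ?thesis using val Alice by simp
  next
    case Bob
    have "x \<le> y" using legal Bob by (simp add: legal_round_def x_def y_def)
    have state_rank': "state_rank (next_state t r) = 2 * (m + y) + (if x = y then 1 else e)"
      using Bob by (cases "holder t") (auto simp: state_rank_def next_state_def m_def x_def y_def e_def tied_def)
    have "odd a \<or> e = 0" if "x = y"
      using tie that Bob by (auto simp: tied_def x_def y_def e_def split: if_splits)
    then have "b \<le> state_rank (next_state t r)"
      using state_rank' bounds(3,4) \<open>x \<le> y\<close> by (cases "x = y") auto
    then show ?thesis using val Bob by simp
  qed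
qed

text \<open>Alice keeps her rank at or above the value. A finished game without her line would then
  demand rank \<open>2 * K\<close>, which the \<open>k\<close> chips in play cannot give.\<close>

lemma sufficient:
  assumes total: "total s = k" and run: "\<not> game_over (board s)"
    and S: "S \<inter> empties (board s) \<noteq> {}"
    and state_rank: "mean (lo (k + 1) S (board s)) (hi (k + 1) (board s)) \<le> state_rank s"
  shows "\<exists>\<sigma>. winning_strategy s \<sigma> \<and> (\<forall>b w. choose_square \<sigma> [] b w \<in> S)"
proof -
  define K where "K = k + 1"
  define B where "B h = board (state_after s h)" for h
  define a where "a h = lo K (allowed S h) (B h)" for h
  define best where "best h = (SOME q. q \<in> allowed S h \<inter> empties (B h) \<and>
    val K (place Alice (B h) q) = a h)" for h
  define \<sigma> where "\<sigma> = \<lparr>bid = \<lambda>h. chips (state_after s h) Alice -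
      (if holder (state_after s h) = Alice then a h div 2 else (a h + 1) div 2),
    declare_winner = \<lambda>h b. if even (a h) then Alice else Bob,
    choose_mover = \<lambda>h b. Alice,
    choose_square = \<lambda>h b w. best h\<rparr>"
  have nonempty: "allowed S h \<inter> empties (B h) \<noteq> {}" if "\<not> game_over (B h)" for h
    using that S by (auto simp: allowed_def B_def state_after_Nil game_over_iff)
  have best: "best h \<in> allowed S h \<inter> empties (B h) \<and> val K (place Alice (B h) (best h)) = a h"
    if "\<not> game_over (B h)" for h
    unfolding best_def a_def by (rule someI_ex) (rule lo_attained[OF nonempty[OF that], of K], blast)
  have legal: "legal_strategy s \<sigma>"
    using best by (auto simp: legal_strategy_def \<sigma>_def B_def empties_def)
  \<comment> \<open>The mean with \<open>a h\<close> replaces \<open>val\<close> because her first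
    move is confined to \<open>S\<close>; from the second round on the two agree.\<close>
  have inv: "(if game_over (B h) then val K (B h) else mean (a h) (hi K (B h))) \<le> state_rank (state_after s h)"
    if "legal_history s h" "follows \<sigma> s h" for h
    using that
  proof (induction h rule: rev_induct)
    case Nil
    then show ?case using run state_rank by (simp add: B_def a_def K_def allowed_def state_after_Nil)
  next
    case (snoc r h)
    define t where "t = state_after s h"
    have hist: "legal_history s h" "\<not> game_over (B h)" "legal_round t r" "follows \<sigma> s h"
        "follows_round \<sigma> h t r"
      using snoc.prems by (auto simp: legal_history_snoc follows_snoc t_def B_def)
    have mean: "mean (a h) (hi K (board t)) \<le> state_rank t"
      using snoc.IH hist by (simp add: t_def B_def)
    have "val K (board (next_state t r)) \<le> state_rank (next_state t r)"
    proof (rule val_after_Alice_round[OF _ _ _ _ hist(3) _ mean])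
      show "bids r Alice = chips t Alice - (if holder t = Alice then a h div 2 else (a h + 1) div 2)"
        using hist(5) by (simp add: follows_round_def \<sigma>_def t_def)
      show "tied (bids r) \<and> holder t = Alice \<longrightarrow> bid_winner r = (if even (a h) then Alice else Bob)"
        using hist(5) by (simp add: follows_round_def \<sigma>_def)
      show "bid_winner r = Alice \<longrightarrow> mover r = Alice"
        using hist(5) by (simp add: follows_round_def \<sigma>_def)
      show "mover r = Alice \<longrightarrow> val K (place Alice (board t) (target r)) = a h"
        using hist(5) best[OF hist(2)] by (simp add: follows_round_def \<sigma>_def B_def t_def)
      show "a h \<le> hi K (board t)"
        using lo_le_hi[OF nonempty[OF hist(2)], of K] by (simp add: a_def B_def t_def)
    qed
    then have "val K (B (h @ [r])) \<le> state_rank (state_after s (h @ [r]))"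
      by (simp add: B_def state_after_snoc t_def)
    then show ?case
      by (cases "game_over (B (h @ [r]))") (simp_all add: a_def allowed_def val_running)
  qed
  have "has_line (B h) Alice"
    if h: "legal_history s h" "follows \<sigma> s h" "game_over (B h)" for h
  proof (rule ccontr)
    assume "\<not> has_line (B h) Alice"
    then have "2 * K \<le> state_rank (state_after s h)"
      using inv[OF h(1,2)] h(3) by (simp add: val_Bob)
    moreover have "chips (state_after s h) Alice \<le> k"
      using total_state_after[OF h(1)] total by (simp add: total_def)
    ultimately show False by (simp add: K_def state_rank_def split: if_splits)
  qed
  with legal have "winning_strategy s \<sigma>"
    by (simp add: winning_strategy_def B_def)
  moreover have "choose_square \<sigma> [] b w \<in> S" for b w
    using best[of "[]"] run by (simp add: \<sigma>_def B_def state_after_Nil allowed_def)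
  ultimately show ?thesis by blast
qed

text \<open>Alice's strategy fixes her bid \<open>x\<close>, so Bob may answer it although bids are
  simultaneous. He underbids if the price ruins her, ties if the outcomes of a tie open to the
  holder allow it, and otherwise bids one more; the bound on \<open>b\<close> makes this
  affordable.\<close>

lemma Bob_bid:
  fixes a b m n x e :: nat
  assumes "2 * m + e < mean a b" "a \<le> b" "b \<le> 2 * (m + n + 1)" "x \<le> m" "e \<le> 1"
  shows "\<exists>y\<le>n.
    y < x \<and> 2 * (m - x) + e < a \<or>
    x < y \<and> 2 * (m + y) + e < b \<or>
    y = x \<and> e = 0 \<and> (2 * (m - x) < a \<or> 2 * (m + x) + 1 < b) \<or>
    y = x \<and> e = 1 \<and> 2 * (m - x) < a \<and> 2 * (m + x) + 1 < b"
proof (cases "2 * (m - x) + e < a")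
  case True
  \<comment> \<open>A bid of \<open>0\<close> cannot be undercut, so Bob ties; then
    \<open>a \<le> b\<close> makes both outcomes of the tie bad for Alice.\<close>
  show ?thesis
  proof (cases "x = 0")
    case x0: True
    then show ?thesis using True assms by (intro exI[of _ 0]) auto
  next
    case False
    then show ?thesis using True by (intro exI[of _ 0]) auto
  qed
next
  case False
  obtain l where l: "m = x + l" using assms(4) le_Suc_ex by blast
  define c r d s where "c = a div 2" and "r = a mod 2" and "d = b div 2" and "s = b mod 2"
  have a: "a = 2 * c + r" and b: "b = 2 * d + s" and rs: "r = 0 \<or> r = 1" "s = 0 \<or> s = 1"
    by (auto simp: c_def r_def d_def s_def)
  have "(a + 1) div 2 = c + r" "b div 2 = d"
    using rs by (auto simp: a b)
  then have mean: "2 * m + e < c + r + d"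
    using assms(1) by (simp add: mean_def)
  have al: "2 * c + r \<le> 2 * l + e" using False by (simp add: a l)
  consider "e = 0" | "e = 1" "2 * l < a" | "e = 1" "a \<le> 2 * l" using assms(5) by linarith
  then show ?thesis
  proof cases
    case 1
    then have "c + r \<le> l" using al rs by auto
    then have "m + x < d" using mean 1 by (simp add: l)
    then have "2 * (m + x) + 1 < b" "x \<le> n" using assms(3) by (simp_all add: b)
    then show ?thesis using 1 by (intro exI[of _ x]) auto
  next
    case 2
    then have "c + r \<le> l + 1" using al rs by auto
    then have "m + x < d" using mean 2 by (simp add: l)
    then have "2 * (m + x) + 1 < b" "x \<le> n" using assms(3) by (simp_all add: b)
    then show ?thesis using 2 by (intro exI[of _ x]) (auto simp: l)
  next
    case 3
    then have "c + r \<le> l" using rs by (auto simp: a)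
    then have "m + x + 1 < d" using mean 3 by (simp add: l)
    then have "2 * (m + (x + 1)) + 1 < b" "x + 1 \<le> n" using assms(3) by (simp_all add: b)
    then show ?thesis using 3 by (intro exI[of _ "x + 1"]) auto
  qed
qed

text \<open>Completes the chosen bids and bid winner to a round consistent with
  \<open>\<sigma>\<close>. If Alice wins but lets Bob move, he reaches \<open>hi\<close>, which is
  at least \<open>lo\<close>.\<close>

lemma Bob_round:
  fixes w :: player
  assumes strat: "bid \<sigma> h \<le> chips t Alice"
      "\<And>b w. choose_square \<sigma> h b w \<in> A \<inter> empties (board t)"
    and run: "\<not> game_over (board t)"
    and y: "y \<le> chips t Bob"
    and b: "b = (\<lambda>p. case p of Alice \<Rightarrow> bid \<sigma> h | Bob \<Rightarrow> y)"
    and w: "b (opponent w) \<le> b w" "tied b \<and> holder t = Alice \<longrightarrow> w = declare_winner \<sigma> h b"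
  shows "\<exists>r. legal_round t r \<and> follows_round \<sigma> h t r \<and> bids r = b \<and> bid_winner r = w \<and>
    (case w of Alice \<Rightarrow> lo K A (board t) | Bob \<Rightarrow> hi K (board t)) \<le> val K (board (next_state t r))"
proof -
  have ne: "empties (board t) \<noteq> {}" using run by (simp add: game_over_iff)
  obtain q where q: "q \<in> empties (board t)" "val K (place Bob (board t) q) = hi K (board t)"
    by (rule hi_attained[OF ne])
  define r where "r = \<lparr>bids = b, bid_winner = w,
    mover = (case w of Alice \<Rightarrow> choose_mover \<sigma> h b | Bob \<Rightarrow> Bob),
    target = (if w = Alice \<and> choose_mover \<sigma> h b = Alice then choose_square \<sigma> h b w else q)\<rparr>"
  have c: "choose_square \<sigma> h b w \<in> A \<inter> empties (board t)" by (rule strat)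
  have "legal_round t r"
    using strat(1) c q(1) y w(1) by (auto simp: legal_round_def r_def b ex_player empties_def)
  moreover have "follows_round \<sigma> h t r"
    using w(2) by (cases w) (auto simp: follows_round_def r_def b)
  moreover have "(case w of Alice \<Rightarrow> lo K A (board t) | Bob \<Rightarrow> hi K (board t))
      \<le> val K (board (next_state t r))"
  proof (cases "w = Alice \<and> choose_mover \<sigma> h b = Alice")
    case True
    then show ?thesis using lo_le[OF c, of K] by (simp add: board_next r_def)
  next
    case False
    then have "mover r = Bob" "target r = q" by (cases w; cases "choose_mover \<sigma> h b"; simp add: r_def)+
    moreover have "lo K A (board t) \<le> hi K (board t)" using c by (intro lo_le_hi) auto
    ultimately show ?thesis using q(2) by (cases w) (auto simp: board_next)
  qed
  ultimately show ?thesis by (intro exI[of _ r]) (simp add: r_def)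
qed

text \<open>Bob keeps Alice's rank strictly below the value. At the end the value is therefore
  positive, which excludes a line of Alice.\<close>

lemma Bob_refutes:
  assumes total: "total s = k" and legal: "legal_strategy s \<sigma>"
    and S: "\<And>b w. choose_square \<sigma> [] b w \<in> S"
  shows "legal_history s h \<Longrightarrow> follows \<sigma> s h \<Longrightarrow>
    state_rank (state_after s h) <
      (if game_over (board (state_after s h)) then val (k + 1) (board (state_after s h))
       else mean (lo (k + 1) (allowed S h) (board (state_after s h))) (hi (k + 1) (board (state_after s h)))) \<Longrightarrow>
    \<exists>h'. legal_history s h' \<and> follows \<sigma> s h' \<and> game_over (board (state_after s h')) \<and>
      \<not> has_line (board (state_after s h')) Alice"
proof (induction "card (empties (board (state_after s h)))" arbitrary: h rule: less_induct)
  case less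
  define t where "t = state_after s h"
  define K where "K = k + 1"
  define A where "A = allowed S h"
  show ?case
  proof (cases "game_over (board t)")
    case True
    then have "state_rank t < val K (board t)" using less.prems by (simp add: t_def K_def)
    then have "\<not> has_line (board t) Alice" by (auto simp: val_Alice)
    then show ?thesis using True less.prems by (auto simp: t_def)
  next
    case False
    have lt: "state_rank t < mean (lo K A (board t)) (hi K (board t))"
      using less.prems False by (simp add: t_def K_def A_def)
    have strat: "bid \<sigma> h \<le> chips t Alice"
        "\<And>b w. choose_square \<sigma> h b w \<in> A \<inter> empties (board t)"
      using legal less.prems False S
      by (auto simp: legal_strategy_def t_def A_def allowed_def empties_def)
    define x m n e where "x = bid \<sigma> h" and "m = chips t Alice" and "n = chips t Bob"
      and "e = (if holder t = Alice then 1 else 0 :: nat)"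
    define a b where "a = lo K A (board t)" and "b = hi K (board t)"
    have k: "m + n = k"
      using total_state_after[OF less.prems(1)] total by (simp add: t_def m_def n_def total_def)
    have ab: "a \<le> b" unfolding a_def b_def using strat(2) by (intro lo_le_hi) blast
    have ne: "empties (board t) \<noteq> {}" using False by (simp add: game_over_iff)
    have b_le: "b \<le> 2 * (m + n + 1)"
    proof -
      obtain q where "val K (place Bob (board t) q) = b"
        unfolding b_def by (rule hi_attained[OF ne])
      then show ?thesis using val_le[of K "place Bob (board t) q"] k by (simp add: K_def)
    qed
    have me: "2 * m + e < mean a b" using lt by (simp add: state_rank_def m_def e_def a_def b_def)
    have "x \<le> m" "e \<le> 1" using strat(1) by (simp_all add: x_def m_def e_def)
    from Bob_bid[OF me ab b_le this] obtain y where y: "y \<le> n" and cases: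
      "y < x \<and> 2 * (m - x) + e < a \<or> x < y \<and> 2 * (m + y) + e < b \<or>
       y = x \<and> e = 0 \<and> (2 * (m - x) < a \<or> 2 * (m + x) + 1 < b) \<or>
       y = x \<and> e = 1 \<and> 2 * (m - x) < a \<and> 2 * (m + x) + 1 < b"
      by blast
    define bb where "bb = (\<lambda>p. case p of Alice \<Rightarrow> x | Bob \<Rightarrow> y)"
    \<comment> \<open>A tie is settled by Alice's declaration if she holds the advantage; otherwise
      Bob picks an outcome that leaves her rank too small.\<close>
    define w where "w = (if y < x then Alice else if x < y then Bob
      else if holder t = Alice then declare_winner \<sigma> h bb
      else if 2 * (m - x) < a then Alice else Bob)"
    have bb: "bb = (\<lambda>p. case p of Alice \<Rightarrow> bid \<sigma> h | Bob \<Rightarrow> y)"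
      unfolding bb_def x_def ..
    have w1: "bb (opponent w) \<le> bb w"
      by (cases w) (auto simp: w_def bb_def split: if_splits)
    have w2: "tied bb \<and> holder t = Alice \<longrightarrow> w = declare_winner \<sigma> h bb"
      by (auto simp: w_def bb_def tied_def)
    obtain r where r: "legal_round t r" "follows_round \<sigma> h t r" "bids r = bb"
        "bid_winner r = w"
        "(case w of Alice \<Rightarrow> a | Bob \<Rightarrow> b) \<le> val K (board (next_state t r))"
      using Bob_round[OF strat False y[unfolded n_def] bb w1 w2, of K] unfolding a_def b_def by blast
    have "state_rank (next_state t r) < (case w of Alice \<Rightarrow> a | Bob \<Rightarrow> b)"
    proof (cases w)
      case Alice
      then have "state_rank (next_state t r) = 2 * (m - x) + (if x = y then 0 else e)"
        using r(3,4) by (cases "holder t") (auto simp: state_rank_def next_state_def m_def e_def tied_def bb_def)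
      then show ?thesis using Alice cases by (auto simp: w_def e_def split: if_splits)
    next
      case Bob
      then have "state_rank (next_state t r) = 2 * (m + y) + (if x = y then 1 else e)"
        using r(3,4) by (cases "holder t") (auto simp: state_rank_def next_state_def m_def e_def tied_def bb_def)
      then show ?thesis using Bob cases by (auto simp: w_def e_def split: if_splits)
    qed
    then have *: "state_rank (state_after s (h @ [r])) < val K (board (state_after s (h @ [r])))"
      using r(5) by (simp add: state_after_snoc t_def)
    have snoc: "legal_history s (h @ [r])" "follows \<sigma> s (h @ [r])"
      using less.prems False r(1,2) by (auto simp: legal_history_snoc follows_snoc t_def)
    have card: "card (empties (board (state_after s (h @ [r])))) < card (empties (board (state_after s h)))"
      using target_empty[OF r(1)] by (simp add: state_after_snoc board_next t_def)
    show ?thesis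
      by (rule less.hyps[OF card snoc]) (use * in \<open>auto simp: allowed_def K_def val_running\<close>)
  qed
qed

lemma opening_iff:
  assumes "total s = k" "\<not> game_over (board s)" "S \<inter> empties (board s) \<noteq> {}"
  shows "(\<exists>\<sigma>. winning_strategy s \<sigma> \<and> (\<forall>b w. choose_square \<sigma> [] b w \<in> S)) \<longleftrightarrow>
    mean (lo (k + 1) S (board s)) (hi (k + 1) (board s)) \<le> state_rank s"
    (is "?L \<longleftrightarrow> ?R")
proof
  assume ?L
  then obtain \<sigma> where \<sigma>: "winning_strategy s \<sigma>" "\<And>b w. choose_square \<sigma> [] b w \<in> S" by blast
  show ?R
  proof (rule ccontr)
    assume "\<not> ?R"
    then show False
      using Bob_refutes[OF assms(1) _ \<sigma>(2), of "[]"] \<sigma> assms(2)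
      by (auto simp: winning_strategy_def legal_history_Nil follows_Nil state_after_Nil allowed_def)
  qed
qed (rule sufficient[OF assms])

section \<open>Quasi-periodic bounds\<close>

definition generators :: "(nat \<times> nat) list" where
  "generators =
     [(0, 1), (2, 1), (3, 1), (0, 2), (0, 3), (0, 4), (5, 3), (5, 4), (5, 1), (6, 3), (6, 4), (6, 1),
     (11, 1), (0, 5), (0, 6), (0, 9), (0, 10), (0, 11), (0, 13), (15, 2), (15, 9), (15, 13), (16,
     10), (16, 3), (5, 10), (5, 13), (5, 14), (17, 3), (18, 3), (18, 1), (19, 13), (20, 3), (20, 14),
     (0, 16), (0, 18), (0, 22), (0, 23), (0, 25), (0, 27), (0, 30), (35, 24), (15, 28), (39, 33),
     (40, 32), (40, 33), (40, 34)]"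

text \<open>Bound \<open>0\<close> is the value after a line of Alice, bound \<open>1\<close> the value of a position won by Bob, and bound
  \<open>n + 2\<close> is the mean of the two bounds in entry \<open>n\<close> of the list.\<close>

function bound :: "nat \<Rightarrow> nat \<Rightarrow> nat" where
  "bound K n =
     (if n = 0 then 0 else if n = 1 then 2 * K
      else (case generators ! (n - 2) of (a, b) \<Rightarrow>
        if a < n \<and> b < n then mean (bound K a) (bound K b) else 0))"
  by auto
termination
  by (relation "measure snd") auto

declare bound.simps [simp del]

lemma bound_0 [simp]: "bound K 0 = 0" and bound_1 [simp]: "bound K (Suc 0) = 2 * K"
  by (simp_all add: bound.simps)

lemma bound_le: "bound K n \<le> 2 * K"
proof (induction K n rule: bound.induct)
  case (1 K n)
  obtain a b where ab: "generators ! (n - 2) = (a, b)" by force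
  have "mean (bound K a) (bound K b) \<le> 2 * K" if "n \<noteq> 0" "n \<noteq> 1" "a < n" "b < n"
    using mean_mono[OF 1(1) 1(2)] ab that by (fastforce simp: mean_def)
  with ab show ?case by (subst bound.simps) auto
qed

lemma length_generators: "length generators = 46"
  by (simp add: generators_def)

lemma generators_below:
  "list_all (\<lambda>(n, a, b). a < n \<and> b < n) (enumerate 2 generators)"
  by (simp add: generators_def)

text \<open>Establishes the guard that makes \<open>bound\<close> terminate, so that each entry
  yields a genuine recursion equation.\<close>

lemma generator_below:
  assumes "n < 46" "generators ! n = (a, b)"
  shows "a < n + 2" "b < n + 2"
proof -
  have "(n + 2, a, b) \<in> set (enumerate 2 generators)"
    using assms by (auto simp: in_set_enumerate_eq length_generators)
  then show "a < n + 2" "b < n + 2"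
    using generators_below by (auto simp: list_all_iff)
qed

lemma bound_generator:
  assumes "n < 46" "generators ! n = (a, b)"
  shows "bound K (n + 2) = mean (bound K a) (bound K b)"
  using generator_below[OF assms] assms by (subst bound.simps) simp

lemma bound_all:
  "list_all (\<lambda>(n, a, b). bound K n = mean (bound K a) (bound K b)) (enumerate 2 generators)"
proof (unfold list_all_iff, intro ballI)
  fix x
  assume x: "x \<in> set (enumerate 2 generators)"
  obtain n a b where nab: "x = (n, a, b)" by (cases x)
  define m where "m = n - 2"
  have "n = m + 2" "m < 46" "generators ! m = (a, b)"
    using x by (auto simp: nab m_def in_set_enumerate_eq length_generators)
  then show "case x of (n, a, b) \<Rightarrow> bound K n = mean (bound K a) (bound K b)"
    using bound_generator nab by simp
qed

lemmas bound_eqs = bound_all[unfolded generators_def, simplified]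

text \<open>This is why the period is 64: adding even numbers commutes with the rounding in
  \<open>mean\<close>. At 64 only the bounds 43 and 47 are odd, and neither occurs in a
  pair.\<close>

lemma generators_even: "list_all (\<lambda>(a, b). even (bound 64 a) \<and> even (bound 64 b)) generators"
  by (simp add: generators_def bound_eqs mean_def)

lemma mean_add_even: "even s \<Longrightarrow> even t \<Longrightarrow> mean (x + s) (y + t) = mean x y + mean s t"
  by (auto simp: mean_def elim!: evenE)

lemma bound_period: "n < 48 \<Longrightarrow> bound (K + 64) n = bound K n + bound 64 n"
proof (induction n rule: less_induct)
  case (less n)
  show ?case
  proof (cases "n < 2")
    case True
    then have "n = 0 \<or> n = 1" by auto
    then show ?thesis by auto
  next
    case False
    define m where "m = n - 2"
    have m: "n = m + 2" "m < 46" using False less.prems by (auto simp: m_def)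
    obtain a b where ab: "generators ! m = (a, b)" by force
    then have "(a, b) \<in> set generators"
      using m by (metis length_generators nth_mem)
    then have "even (bound 64 a)" "even (bound 64 b)"
      using generators_even by (auto simp: list_all_iff)
    moreover have "a < n" "b < n"
      using generator_below[OF m(2) ab] m by auto
    ultimately show ?thesis
      using less.IH[of a] less.IH[of b] less.prems
      unfolding m(1) bound_generator[OF m(2) ab] by (simp add: mean_add_even)
  qed
qed

text \<open>The order facts available to the table checks. Transitivity is not applied there, so
  every inequality needed is listed by itself.\<close>

definition comparisons :: "(nat \<times> nat) list" where
  "comparisons =
     [(2, 3), (2, 8), (2, 9), (2, 10), (2, 11), (2, 13), (3, 4), (5, 2), (5, 6), (5, 7), (5, 8), (5,
     10), (5, 18), (5, 20), (5, 23), (5, 24), (5, 25), (5, 26), (5, 27), (6, 2), (6, 3), (6, 8), (6,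
     9), (6, 10), (6, 11), (6, 13), (6, 25), (8, 2), (8, 3), (8, 13), (8, 33), (9, 3), (10, 3), (10,
     4), (11, 3), (11, 13), (11, 14), (12, 3), (13, 3), (13, 4), (15, 5), (15, 16), (15, 18), (15,
     36), (15, 37), (15, 38), (15, 40), (15, 42), (16, 5), (16, 18), (16, 22), (17, 25), (18, 2),
     (18, 9), (18, 10), (18, 25), (18, 27), (19, 20), (19, 27), (20, 6), (20, 8), (20, 11), (20, 13),
     (20, 27), (20, 28), (20, 30), (27, 13), (27, 32), (27, 33), (29, 33), (30, 3), (30, 13), (31,
     3), (31, 13), (33, 13), (35, 15), (35, 36), (40, 5), (40, 21), (40, 41), (40, 43)]"

definition comparable :: "nat \<Rightarrow> bool" where
  "comparable K \<longleftrightarrow> list_all (\<lambda>(i, j). bound K i \<le> bound K j) comparisons"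

lemma comparable_upto: "list_all comparable [0..<65]"
  by (simp add: upt_rec comparable_def comparisons_def bound_eqs mean_def)

lemma comparisons_range: "list_all (\<lambda>(i, j). i < 48 \<and> j < 48) comparisons"
  by (simp add: comparisons_def)

lemma bound_le_of_comparison:
  assumes "(i, j) \<in> set comparisons"
  shows "bound K i \<le> bound K j"
proof (induction K rule: less_induct)
  case (less K)
  \<comment> \<open>The base includes \<open>K = 64\<close>, which compares the increments per
    period that the step adds.\<close>
  have base: "bound K i \<le> bound K j" if "K < 65" for K
    using comparable_upto assms that by (auto simp: list_all_iff comparable_def)
  show ?case
  proof (cases "K < 65")
    case False
    have "i < 48" "j < 48" using comparisons_range assms by (auto simp: list_all_iff)
    then have "bound (K - 64 + 64) i \<le> bound (K - 64 + 64) j"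
      using less.IH[of "K - 64"] base[of 64] False unfolding bound_period[OF \<open>i < 48\<close>] bound_period[OF \<open>j < 48\<close>]
      by (intro add_mono) auto
    then show ?thesis using False by simp
  qed (rule base)
qed

text \<open>Hiding the quantifier over \<open>K\<close> turns the comparison of bounds into a
  relation between indices that rewriting can decide.\<close>

definition le :: "nat \<Rightarrow> nat \<Rightarrow> bool" where
  "le i j \<longleftrightarrow> (\<forall>K. bound K i \<le> bound K j)"

lemma le_simps [simp]: "le 0 i" "le i i" "le i (Suc 0)"
  by (simp_all add: le_def bound_le)

lemma le_all: "list_all (\<lambda>(i, j). le i j) comparisons"
  using bound_le_of_comparison by (auto simp: list_all_iff le_def)

lemmas le_facts = le_all[unfolded comparisons_def, simplified]

definition gen :: "nat \<Rightarrow> nat \<times> nat" where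
  "gen i = generators ! (i - 2)"

lemma gen_all: "list_all (\<lambda>(n, ab). gen n = ab) (enumerate 2 generators)"
  by (auto simp: list_all_iff in_set_enumerate_eq gen_def)

lemmas gen_eqs = gen_all[unfolded generators_def, simplified]

lemma gen_bound:
  assumes "1 < i" "i < 48"
  shows "bound K i = mean (bound K (fst (gen i))) (bound K (snd (gen i)))"
proof -
  have "i = i - 2 + 2" "i - 2 < 46" using assms by auto
  then show ?thesis using bound_generator[of "i - 2"] by (metis gen_def prod.collapse)
qed

section \<open>Strategy tables\<close>

datatype trie = Lf | Cl nat | Nd trie trie trie

fun look :: "trie \<Rightarrow> player option list \<Rightarrow> nat option" where
  "look (Cl i) [] = Some i"
| "look (Nd e a b) (None # cs) = look e cs"
| "look (Nd e a b) (Some Alice # cs) = look a cs"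
| "look (Nd e a b) (Some Bob # cs) = look b cs"
| "look _ _ = None"

fun every :: "(player option list \<Rightarrow> nat \<Rightarrow> bool) \<Rightarrow> trie \<Rightarrow> player option list \<Rightarrow> bool" where
  "every P Lf cs = True"
| "every P (Cl i) cs = P cs i"
| "every P (Nd e a b) cs \<longleftrightarrow>
     every P e (cs @ [None]) \<and> every P a (cs @ [Some Alice]) \<and> every P b (cs @ [Some Bob])"

lemma every_look: "every P t pre \<Longrightarrow> look t cs = Some i \<Longrightarrow> P (pre @ cs) i"
proof (induction t cs arbitrary: pre rule: look.induct)
  case (2 e a b cs)
  then show ?case using "2.IH"[of "pre @ [None]"] by simp
next
  case (3 e a b cs)
  then show ?case using "3.IH"[of "pre @ [Some Alice]"] by simp
next
  case (4 e a b cs)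
  then show ?case using "4.IH"[of "pre @ [Some Bob]"] by simp
qed auto

text \<open>A path of a table spells the cells of a position row by row. Its leaf is the index of a bound whose
  generating pair bounds the values after one good move of the owner of the table (Alice for the
  upper, Bob for the lower bounds) and after all moves of the opponent. The tables were found by
  computer search.\<close>

definition upper_table :: trie where
  "upper_table =
     Nd (Nd (Nd (Nd (Nd (Nd (Nd (Nd (Nd Lf (Cl 44) Lf) Lf (Nd Lf (Cl 8) Lf)) (Nd (Nd Lf (Cl 39) (Cl
     29)) Lf (Nd Lf (Cl 25) (Cl 30))) Lf) Lf (Nd (Nd Lf Lf (Nd Lf (Cl 12) Lf)) (Nd (Nd (Cl 27) (Cl 5)
     (Cl 13)) Lf (Nd (Cl 30) (Cl 8) (Cl 13))) (Nd (Nd Lf (Cl 12) Lf) Lf (Nd Lf (Cl 13) Lf)))) (Nd (Nd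
     (Nd (Nd (Cl 45) Lf (Cl 32)) (Nd (Cl 40) Lf (Cl 19)) (Nd (Cl 27) Lf (Cl 13))) (Nd Lf Lf (Nd Lf
     (Cl 16) (Cl 6))) (Nd (Nd Lf Lf (Cl 13)) (Nd Lf Lf (Cl 6)) Lf)) (Nd (Nd Lf Lf (Nd (Cl 5) Lf (Cl
     2))) Lf (Nd (Nd (Cl 20) Lf (Cl 2)) Lf (Nd (Cl 2) Lf Lf))) (Nd (Nd Lf Lf (Nd (Cl 11) (Cl 6) (Cl
     3))) (Nd Lf Lf (Nd Lf (Cl 5) (Cl 2))) (Nd (Nd (Cl 11) (Cl 6) (Cl 3)) (Nd (Cl 6) Lf (Cl 2)) (Nd
     (Cl 3) (Cl 2) Lf)))) (Nd (Nd (Nd (Nd Lf (Cl 33) Lf) (Nd Lf (Cl 20) Lf) (Nd Lf (Cl 3) Lf)) (Nd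
     (Nd Lf (Cl 6) (Cl 13)) (Nd Lf Lf (Cl 13)) (Nd Lf (Cl 3) (Cl 3))) Lf) (Nd (Nd Lf Lf (Nd Lf (Cl 2)
     Lf)) (Nd Lf Lf (Nd Lf (Cl 2) Lf)) (Nd (Nd Lf (Cl 2) Lf) Lf Lf)) (Nd (Nd Lf Lf (Nd Lf (Cl 4) Lf))
     (Nd (Nd (Cl 13) (Cl 2) Lf) (Nd (Cl 2) Lf Lf) (Nd (Cl 3) (Cl 3) Lf)) (Nd (Nd Lf (Cl 4) Lf) Lf
     Lf)))) (Nd Lf (Nd Lf Lf (Nd (Nd (Nd (Cl 27) Lf (Cl 13)) Lf (Nd (Cl 8) Lf (Cl 3))) (Nd (Nd (Cl 5)
     Lf (Cl 2)) Lf (Nd (Cl 5) Lf (Cl 2))) (Nd (Nd (Cl 11) (Cl 6) (Cl 3)) (Nd Lf Lf (Cl 2)) (Nd (Cl 3)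
     (Cl 2) Lf)))) (Nd Lf Lf (Nd Lf (Nd (Nd (Cl 6) Lf (Cl 2)) Lf (Nd (Cl 2) (Cl 2) Lf)) Lf))) (Nd (Nd
     Lf Lf (Nd (Nd (Nd Lf (Cl 31) Lf) Lf (Nd Lf (Cl 13) Lf)) (Nd (Nd Lf (Cl 2) (Cl 3)) Lf (Nd Lf (Cl
     10) Lf)) Lf)) (Nd Lf Lf (Nd (Nd (Nd (Cl 27) (Cl 18) (Cl 13)) (Nd (Cl 5) Lf (Cl 2)) (Nd (Cl 11)
     (Cl 6) (Cl 3))) (Nd (Nd Lf Lf (Cl 2)) Lf (Nd Lf (Cl 5) (Cl 2))) Lf)) Lf)) (Nd (Nd (Nd (Nd Lf (Nd
     Lf Lf (Nd Lf Lf (Cl 6))) (Nd (Nd (Cl 29) (Cl 17) (Cl 3)) Lf (Nd (Cl 31) (Cl 18) Lf))) Lf (Nd Lf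
     (Nd Lf Lf (Nd Lf Lf (Cl 6))) (Nd (Nd (Cl 12) (Cl 9) (Cl 3)) Lf (Nd (Cl 3) (Cl 10) Lf)))) (Nd Lf
     Lf (Nd Lf Lf (Nd (Nd Lf (Cl 6) (Cl 3)) (Nd Lf Lf (Cl 2)) (Nd Lf (Cl 2) Lf)))) (Nd (Nd Lf (Nd Lf
     Lf (Nd Lf Lf (Cl 3))) (Nd (Nd (Cl 11) (Cl 6) (Cl 3)) (Nd Lf (Cl 6) Lf) (Nd (Cl 3) (Cl 2) Lf)))
     (Nd Lf Lf (Nd (Nd (Cl 6) Lf (Cl 3)) Lf (Nd (Cl 2) Lf Lf))) (Nd Lf (Nd Lf Lf (Nd Lf Lf (Cl 3)))
     (Nd (Nd (Cl 3) (Cl 3) Lf) (Nd Lf (Cl 3) Lf) Lf)))) (Nd Lf (Nd Lf Lf (Nd (Nd (Nd Lf Lf (Cl 6)) Lf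
     (Nd Lf Lf (Cl 2))) Lf (Nd (Nd Lf Lf (Cl 3)) (Nd Lf Lf (Cl 2)) Lf))) (Nd (Nd Lf (Nd Lf Lf (Nd Lf
     Lf (Cl 2))) Lf) Lf (Nd Lf (Nd Lf Lf (Nd Lf Lf (Cl 2))) Lf))) (Nd (Nd (Nd (Nd (Nd Lf (Cl 18) (Cl
     11)) Lf (Nd (Cl 30) (Cl 18) (Cl 13))) (Nd Lf Lf (Nd Lf Lf (Cl 6))) (Nd (Nd Lf (Cl 2) (Cl 3)) Lf
     (Nd (Cl 3) (Cl 2) Lf))) Lf (Nd (Nd (Nd Lf (Cl 10) (Cl 13)) Lf (Nd (Cl 13) (Cl 10) Lf)) (Nd (Nd
     Lf Lf (Cl 2)) Lf (Nd Lf Lf (Cl 2))) (Nd (Nd (Cl 3) (Cl 3) Lf) Lf Lf))) (Nd (Nd (Nd Lf Lf (Nd (Cl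
     6) Lf (Cl 2))) Lf (Nd Lf Lf (Nd (Cl 3) Lf Lf))) (Nd (Nd (Nd Lf Lf (Cl 6)) Lf (Nd (Cl 5) Lf (Cl
     2))) Lf (Nd (Nd (Cl 2) Lf (Cl 3)) (Nd Lf Lf (Cl 2)) (Nd (Cl 2) Lf Lf))) (Nd (Nd (Nd Lf (Cl 5)
     (Cl 6)) Lf (Nd (Cl 6) (Cl 5) (Cl 2))) Lf (Nd (Nd (Cl 10) (Cl 2) (Cl 3)) (Nd Lf Lf (Cl 2)) (Nd
     (Cl 3) (Cl 2) Lf)))) (Nd (Nd (Nd (Nd Lf (Cl 2) (Cl 3)) Lf (Nd (Cl 3) (Cl 2) Lf)) (Nd Lf Lf (Nd
     Lf Lf (Cl 3))) (Nd (Nd Lf (Cl 2) Lf) (Nd Lf (Cl 2) Lf) Lf)) (Nd (Nd (Nd Lf Lf (Cl 3)) Lf (Nd (Cl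
     2) Lf Lf)) Lf (Nd (Nd (Cl 2) Lf Lf) Lf Lf)) Lf))) (Nd (Nd (Nd (Nd Lf Lf (Nd (Nd Lf (Cl 13) Lf)
     Lf (Nd Lf (Cl 13) Lf))) Lf Lf) (Nd (Nd Lf Lf (Nd (Nd (Cl 33) (Cl 6) (Cl 3)) (Nd (Cl 20) Lf (Cl
     2)) (Nd (Cl 13) (Cl 6) Lf))) (Nd Lf Lf (Nd Lf Lf (Nd (Cl 2) Lf Lf))) (Nd Lf Lf (Nd Lf Lf (Nd Lf
     (Cl 2) Lf)))) Lf) (Nd Lf (Nd (Nd (Nd (Nd Lf Lf (Cl 2)) Lf (Nd (Cl 6) Lf (Cl 2))) Lf (Nd (Nd Lf
     Lf (Cl 2)) Lf (Nd (Cl 2) Lf Lf))) Lf (Nd (Nd Lf Lf (Nd (Cl 3) (Cl 2) Lf)) (Nd Lf Lf (Nd (Cl 2)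
     Lf Lf)) (Nd (Nd (Cl 13) (Cl 6) Lf) Lf (Nd Lf (Cl 2) Lf)))) (Nd (Nd Lf (Nd (Nd Lf Lf (Cl 2)) Lf
     (Nd (Cl 2) Lf Lf)) Lf) (Nd Lf (Nd Lf Lf (Nd Lf (Cl 2) Lf)) Lf) Lf)) (Nd (Nd (Nd (Nd Lf Lf (Nd Lf
     (Cl 3) Lf)) (Nd (Nd Lf (Cl 6) (Cl 4)) (Nd Lf Lf (Cl 3)) (Nd (Cl 4) (Cl 3) Lf)) (Nd (Nd Lf (Cl 3)
     Lf) Lf Lf)) Lf (Nd Lf (Nd (Nd Lf (Cl 2) Lf) Lf Lf) Lf)) (Nd (Nd (Nd (Nd Lf Lf (Cl 3)) (Nd Lf Lf
     (Cl 2)) (Nd (Cl 3) (Cl 2) Lf)) (Nd (Nd Lf Lf (Cl 3)) (Nd Lf Lf (Cl 2)) (Nd (Cl 3) (Cl 2) Lf))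
     (Nd (Nd Lf (Cl 2) Lf) Lf (Nd Lf (Cl 2) Lf))) (Nd (Nd (Nd Lf Lf (Cl 3)) (Nd Lf Lf (Cl 2)) (Nd (Cl
     3) (Cl 2) Lf)) (Nd (Nd Lf Lf (Cl 3)) (Nd Lf Lf (Cl 2)) Lf) (Nd (Nd Lf (Cl 2) Lf) Lf Lf)) (Nd (Nd
     Lf (Nd (Cl 2) Lf Lf) (Nd (Cl 3) (Cl 2) Lf)) (Nd (Nd Lf (Cl 5) Lf) Lf (Nd (Cl 3) (Cl 2) Lf)) (Nd
     (Nd Lf (Cl 2) Lf) Lf Lf))) (Nd (Nd Lf (Nd (Nd Lf (Cl 2) Lf) Lf Lf) Lf) (Nd (Nd Lf (Nd Lf (Cl 2)
     Lf) Lf) (Nd (Nd Lf (Cl 2) Lf) Lf Lf) Lf) Lf)))) (Nd (Nd Lf Lf (Nd Lf (Nd Lf Lf (Nd (Nd Lf Lf (Nd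
     (Cl 8) Lf (Cl 3))) Lf Lf)) Lf)) (Nd Lf Lf (Nd Lf (Nd (Nd (Nd Lf Lf (Nd Lf Lf (Cl 2))) Lf Lf) Lf
     (Nd (Nd Lf Lf (Nd (Cl 5) Lf (Cl 2))) Lf (Nd Lf Lf (Nd (Cl 2) Lf Lf)))) Lf)) (Nd Lf Lf (Nd Lf (Nd
     (Nd (Nd Lf Lf (Nd Lf (Cl 2) Lf)) Lf (Nd Lf Lf (Nd Lf (Cl 2) Lf))) Lf (Nd (Nd Lf Lf (Nd (Cl 3) Lf
     Lf)) Lf Lf)) Lf))) (Nd (Nd Lf Lf (Nd (Nd Lf Lf (Nd Lf (Nd (Nd Lf (Cl 2) Lf) Lf Lf) Lf)) (Nd Lf
     Lf (Nd (Nd Lf Lf (Nd (Cl 11) (Cl 6) (Cl 3))) (Nd (Nd Lf Lf (Cl 2)) (Nd Lf Lf (Cl 2)) (Nd Lf (Cl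
     5) (Cl 2))) Lf)) Lf)) (Nd Lf Lf (Nd (Nd (Nd Lf (Nd Lf Lf (Nd Lf Lf (Cl 2))) (Nd (Nd Lf (Cl 2)
     Lf) Lf Lf)) Lf Lf) (Nd (Nd Lf Lf (Nd Lf Lf (Nd Lf (Cl 2) Lf))) Lf (Nd Lf Lf (Nd (Nd Lf (Cl 2)
     Lf) Lf (Nd (Cl 3) (Cl 2) Lf)))) Lf)) Lf)) (Nd (Nd Lf (Nd (Nd (Nd (Nd Lf Lf (Nd (Nd Lf Lf (Cl 2))
     Lf Lf)) Lf (Nd Lf Lf (Nd (Nd Lf (Cl 5) (Cl 2)) Lf (Nd Lf (Cl 5) Lf)))) Lf (Nd (Nd Lf Lf (Nd (Nd
     Lf Lf (Cl 2)) Lf Lf)) (Nd Lf Lf (Nd (Nd Lf Lf (Cl 2)) Lf Lf)) (Nd Lf Lf (Nd (Nd Lf (Cl 2) Lf) Lf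
     (Nd Lf (Cl 2) Lf))))) Lf (Nd (Nd Lf Lf (Nd Lf (Nd (Nd Lf Lf (Cl 2)) Lf (Nd Lf Lf (Cl 2))) Lf))
     (Nd Lf Lf (Nd Lf Lf (Nd (Nd Lf Lf (Cl 2)) Lf Lf))) Lf)) (Nd (Nd (Nd (Nd Lf Lf (Nd Lf Lf (Nd Lf
     (Cl 2) Lf))) Lf (Nd Lf Lf (Nd Lf Lf (Nd Lf (Cl 2) Lf)))) (Nd (Nd Lf Lf (Nd (Nd Lf Lf (Cl 3)) (Nd
     Lf Lf (Cl 2)) Lf)) Lf Lf) Lf) Lf (Nd (Nd (Nd Lf (Nd (Nd Lf Lf (Cl 4)) Lf (Nd Lf (Cl 2) Lf)) (Nd
     Lf Lf (Nd Lf (Cl 2) Lf))) Lf (Nd Lf (Nd Lf Lf (Nd Lf (Cl 2) Lf)) Lf)) (Nd (Nd Lf (Nd (Nd Lf Lf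
     (Cl 3)) (Nd Lf Lf (Cl 2)) Lf) (Nd (Nd Lf Lf (Cl 3)) (Nd Lf Lf (Cl 2)) Lf)) (Nd Lf Lf (Nd (Nd Lf
     Lf (Cl 3)) (Nd Lf Lf (Cl 2)) Lf)) Lf) Lf))) Lf Lf) Lf"

definition lower_table :: trie where
  "lower_table =
     Nd (Nd (Nd (Nd (Nd (Nd (Nd (Nd Lf (Nd (Cl 47) (Cl 5) Lf) Lf) (Nd (Nd Lf (Cl 39) Lf) (Nd Lf Lf
     (Cl 8)) (Nd Lf (Cl 25) Lf)) Lf) (Nd (Nd Lf (Nd (Cl 43) (Cl 36) Lf) Lf) (Nd (Nd (Cl 21) (Cl 15)
     Lf) (Nd (Cl 38) Lf (Cl 23)) (Nd Lf (Cl 5) Lf)) (Nd Lf (Nd Lf (Cl 18) Lf) Lf)) Lf) (Nd (Nd (Nd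
     (Nd (Cl 45) (Cl 40) (Cl 32)) (Nd (Cl 40) Lf (Cl 19)) Lf) (Nd (Nd Lf Lf (Cl 20)) (Nd Lf Lf (Cl
     5)) (Nd Lf (Cl 16) Lf)) (Nd (Nd Lf Lf (Cl 13)) (Nd Lf Lf (Cl 6)) Lf)) (Nd (Nd Lf (Nd (Cl 15) Lf
     Lf) Lf) (Nd (Nd (Cl 15) Lf Lf) (Nd Lf Lf (Cl 15)) Lf) (Nd (Nd (Cl 20) Lf (Cl 2)) Lf Lf)) Lf) (Nd
     (Nd (Nd (Nd Lf (Cl 33) Lf) (Nd (Cl 34) (Cl 20) (Cl 14)) (Nd Lf (Cl 3) Lf)) (Nd (Nd Lf (Cl 6) Lf)
     (Nd Lf Lf (Cl 13)) (Nd Lf (Cl 3) Lf)) Lf) (Nd (Nd Lf (Nd (Cl 28) (Cl 5) (Cl 14)) (Nd Lf (Cl 2)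
     Lf)) (Nd (Nd (Cl 8) (Cl 5) (Cl 13)) (Nd (Cl 20) Lf (Cl 13)) (Nd (Cl 3) (Cl 2) Lf)) (Nd Lf (Nd
     (Cl 13) (Cl 2) Lf) Lf)) (Nd Lf (Nd (Nd Lf (Cl 2) Lf) Lf Lf) Lf))) (Nd (Nd Lf (Nd (Nd (Nd (Cl 41)
     (Cl 36) Lf) (Nd (Cl 40) Lf Lf) Lf) (Nd Lf (Nd Lf Lf (Cl 5)) Lf) Lf) Lf) (Nd Lf Lf (Nd (Nd (Nd
     (Cl 27) (Cl 5) (Cl 13)) (Nd (Cl 5) Lf (Cl 2)) Lf) (Nd (Nd (Cl 5) Lf (Cl 2)) Lf Lf) (Nd (Nd (Cl
     11) (Cl 6) Lf) (Nd (Cl 6) Lf Lf) Lf))) (Nd Lf (Nd (Nd (Nd (Cl 30) (Cl 18) (Cl 13)) (Nd (Cl 27)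
     (Cl 5) (Cl 13)) (Nd (Cl 3) (Cl 2) Lf)) (Nd (Nd Lf Lf (Cl 2)) (Nd Lf Lf (Cl 2)) Lf) Lf) (Nd (Nd
     (Nd Lf (Cl 9) Lf) (Nd Lf (Cl 7) Lf) Lf) (Nd (Nd Lf (Cl 5) Lf) Lf (Nd Lf (Cl 2) Lf)) (Nd (Nd Lf
     (Cl 4) Lf) (Nd Lf (Cl 4) Lf) Lf)))) Lf) (Nd (Nd (Nd (Nd Lf (Nd (Nd (Cl 40) Lf Lf) (Nd (Cl 36) Lf
     (Cl 18)) (Nd Lf (Cl 5) Lf)) (Nd Lf (Nd Lf (Cl 5) Lf) Lf)) (Nd Lf (Nd Lf (Nd Lf Lf (Cl 18)) Lf)
     (Nd (Nd Lf Lf (Cl 3)) (Nd Lf Lf (Cl 8)) Lf)) Lf) (Nd (Nd Lf Lf (Nd (Nd (Cl 27) (Cl 5) (Cl 13))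
     (Nd (Cl 5) Lf (Cl 6)) Lf)) (Nd Lf Lf (Nd (Nd (Cl 5) Lf (Cl 2)) (Nd Lf Lf (Cl 5)) Lf)) (Nd Lf Lf
     (Nd (Nd Lf (Cl 6) Lf) Lf Lf))) (Nd (Nd Lf (Nd (Nd (Cl 27) (Cl 5) Lf) (Nd (Cl 18) Lf (Cl 10)) (Nd
     (Cl 13) (Cl 2) Lf)) (Nd Lf (Nd (Cl 11) (Cl 6) (Cl 3)) Lf)) (Nd Lf (Nd Lf (Nd Lf Lf (Cl 10)) (Nd
     (Cl 2) Lf Lf)) (Nd Lf (Nd (Cl 6) Lf (Cl 3)) Lf)) (Nd Lf Lf (Nd Lf (Nd Lf (Cl 3) Lf) Lf)))) (Nd
     (Nd (Nd (Nd (Nd Lf (Cl 37) Lf) (Nd (Cl 42) (Cl 15) Lf) Lf) (Nd Lf (Nd (Cl 15) Lf Lf) Lf) (Nd Lf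
     (Nd Lf (Cl 5) Lf) Lf)) (Nd (Nd (Nd Lf Lf (Cl 18)) (Nd (Cl 36) Lf (Cl 18)) Lf) Lf (Nd (Nd Lf Lf
     (Cl 2)) (Nd Lf Lf (Cl 6)) Lf)) (Nd (Nd (Nd Lf (Cl 22) Lf) (Nd Lf (Cl 5) Lf) Lf) (Nd (Nd Lf (Cl
     15) Lf) Lf Lf) (Nd (Nd Lf (Cl 9) Lf) (Nd Lf (Cl 8) Lf) Lf))) (Nd (Nd (Nd Lf (Nd (Cl 35) Lf Lf)
     Lf) Lf (Nd (Nd Lf Lf (Cl 2)) (Nd (Cl 16) Lf Lf) Lf)) Lf (Nd (Nd (Nd Lf (Cl 16) (Cl 6)) Lf Lf) Lf
     (Nd (Nd (Cl 8) (Cl 6) (Cl 3)) (Nd (Cl 6) (Cl 5) (Cl 2)) Lf))) (Nd (Nd (Nd (Nd Lf (Cl 5) Lf) (Nd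
     (Cl 24) (Cl 16) (Cl 10)) (Nd Lf (Cl 2) Lf)) (Nd Lf (Nd (Cl 5) Lf (Cl 2)) (Nd (Cl 2) Lf Lf)) (Nd
     (Nd Lf (Cl 6) Lf) (Nd (Cl 11) (Cl 6) (Cl 3)) Lf)) (Nd (Nd (Nd Lf Lf (Cl 10)) (Nd (Cl 18) Lf (Cl
     10)) (Nd (Cl 2) Lf Lf)) (Nd (Nd Lf Lf (Cl 2)) (Nd Lf Lf (Cl 2)) Lf) (Nd (Nd (Cl 6) Lf (Cl 3))
     (Nd (Cl 6) Lf (Cl 3)) Lf)) (Nd (Nd (Nd Lf (Cl 8) Lf) (Nd (Cl 8) (Cl 6) Lf) Lf) (Nd (Nd (Cl 6)
     (Cl 5) Lf) (Nd (Cl 5) Lf Lf) Lf) (Nd (Nd Lf (Cl 3) Lf) (Nd Lf (Cl 3) Lf) Lf)))) (Nd Lf (Nd Lf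
     (Nd (Nd (Nd Lf Lf (Cl 6)) Lf Lf) Lf (Nd (Nd (Cl 2) Lf (Cl 3)) (Nd Lf Lf (Cl 2)) Lf)) Lf) (Nd (Nd
     Lf (Nd (Nd Lf (Cl 2) Lf) Lf Lf) Lf) (Nd Lf (Nd (Nd Lf Lf (Cl 3)) (Nd Lf Lf (Cl 3)) Lf) Lf) Lf)))
     (Nd (Nd (Nd Lf (Nd Lf Lf (Nd Lf (Nd Lf (Cl 10) Lf) Lf)) Lf) (Nd Lf (Nd Lf Lf (Nd Lf (Nd Lf (Cl
     5) Lf) Lf)) Lf) Lf) (Nd (Nd (Nd Lf (Nd Lf (Nd Lf Lf (Cl 2)) Lf) Lf) (Nd Lf (Nd Lf (Nd Lf Lf (Cl
     5)) Lf) (Nd Lf (Nd Lf (Cl 2) Lf) Lf)) Lf) (Nd (Nd (Nd (Nd Lf Lf (Cl 2)) Lf Lf) (Nd (Nd Lf Lf (Cl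
     2)) Lf Lf) Lf) Lf (Nd (Nd Lf (Nd (Cl 2) Lf Lf) Lf) Lf Lf)) (Nd Lf (Nd (Nd Lf (Nd (Cl 10) (Cl 2)
     Lf) Lf) (Nd (Nd Lf (Cl 5) (Cl 2)) (Nd (Cl 5) Lf (Cl 2)) (Nd Lf (Cl 2) Lf)) Lf) Lf)) (Nd Lf (Nd
     Lf (Nd (Nd (Nd Lf Lf (Cl 3)) (Nd (Cl 6) Lf (Cl 2)) Lf) (Nd (Nd Lf (Cl 5) (Cl 3)) (Nd (Cl 5) Lf
     (Cl 2)) (Nd Lf (Cl 2) Lf)) (Nd Lf (Nd Lf (Cl 2) Lf) Lf)) Lf) Lf))) (Nd (Nd Lf (Nd Lf (Nd Lf Lf
     (Nd Lf Lf (Nd Lf Lf (Nd (Cl 3) (Cl 2) Lf)))) (Nd Lf (Nd (Nd Lf (Nd (Cl 26) (Cl 5) (Cl 10)) (Nd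
     (Cl 8) (Cl 6) Lf)) (Nd (Nd Lf Lf (Cl 2)) (Nd Lf Lf (Cl 2)) Lf) Lf) (Nd Lf (Nd (Nd Lf (Cl 5) Lf)
     (Nd (Cl 5) Lf Lf) (Nd Lf (Cl 2) Lf)) (Nd (Nd Lf (Cl 3) Lf) (Nd (Cl 3) (Cl 3) Lf) Lf)))) Lf) (Nd
     Lf (Nd (Nd Lf Lf (Nd Lf Lf (Nd (Nd Lf (Cl 6) Lf) (Nd Lf (Cl 5) Lf) Lf))) (Nd Lf Lf (Nd Lf Lf (Nd
     (Nd Lf Lf (Cl 2)) Lf (Nd (Cl 2) Lf Lf)))) (Nd (Nd Lf Lf (Nd (Nd Lf (Cl 5) Lf) (Nd Lf (Cl 5) (Cl
     2)) Lf)) (Nd Lf Lf (Nd (Nd Lf Lf (Cl 2)) (Nd (Cl 5) Lf (Cl 2)) Lf)) (Nd Lf Lf (Nd (Nd Lf (Cl 2)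
     Lf) (Nd (Cl 2) (Cl 2) Lf) Lf)))) (Nd Lf (Nd Lf (Nd (Nd Lf Lf (Nd Lf Lf (Cl 2))) Lf (Nd (Nd Lf Lf
     (Cl 2)) Lf Lf)) Lf) (Nd Lf (Nd (Nd Lf (Nd Lf Lf (Cl 2)) Lf) (Nd (Nd Lf Lf (Cl 2)) (Nd Lf Lf (Cl
     2)) Lf) Lf) Lf))) (Nd Lf Lf (Nd Lf (Nd Lf (Nd (Nd Lf Lf (Nd (Cl 3) (Cl 2) Lf)) (Nd (Nd Lf Lf (Cl
     2)) Lf (Nd (Cl 3) (Cl 2) Lf)) Lf) Lf) Lf))) Lf) (Nd (Nd Lf (Nd (Nd (Nd Lf (Nd Lf Lf (Nd (Nd Lf
     Lf (Cl 2)) (Nd Lf Lf (Cl 6)) Lf)) Lf) (Nd (Nd Lf Lf (Nd (Nd Lf Lf (Cl 2)) Lf Lf)) Lf Lf) (Nd (Nd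
     Lf (Nd Lf (Nd Lf Lf (Cl 5)) Lf) (Nd Lf (Nd Lf Lf (Cl 2)) Lf)) (Nd Lf (Nd Lf (Nd Lf Lf (Cl 5))
     (Nd Lf Lf (Cl 2))) (Nd Lf (Nd Lf Lf (Cl 2)) Lf)) (Nd Lf Lf (Nd Lf (Nd Lf (Cl 2) Lf) Lf)))) (Nd
     (Nd Lf Lf (Nd Lf Lf (Nd (Nd Lf (Cl 5) Lf) (Nd Lf (Cl 5) Lf) Lf))) (Nd Lf Lf (Nd Lf Lf (Nd (Nd Lf
     Lf (Cl 2)) Lf Lf))) (Nd Lf (Nd Lf Lf (Nd (Nd Lf Lf (Cl 2)) (Nd Lf Lf (Cl 2)) Lf)) (Nd Lf Lf (Nd
     (Nd Lf (Cl 2) Lf) (Nd Lf (Cl 2) Lf) Lf)))) Lf) (Nd (Nd (Nd Lf (Nd Lf Lf (Nd Lf (Nd Lf (Cl 2) Lf)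
     Lf)) Lf) Lf Lf) Lf (Nd (Nd Lf (Nd Lf (Nd (Nd Lf Lf (Cl 4)) (Nd Lf Lf (Cl 3)) Lf) Lf) Lf) (Nd (Nd
     Lf (Nd (Nd Lf Lf (Cl 3)) (Nd Lf Lf (Cl 2)) Lf) Lf) (Nd Lf (Nd (Nd Lf Lf (Cl 3)) (Nd Lf Lf (Cl
     2)) Lf) Lf) Lf) Lf))) (Nd Lf Lf (Nd Lf Lf (Nd (Nd Lf (Nd Lf (Nd Lf (Nd Lf Lf (Cl 2)) Lf) Lf) Lf)
     Lf Lf))) Lf) Lf"

fun line :: "player \<Rightarrow> player option list \<Rightarrow> bool" where
  "line p [a, b, c, d, e, f, g, h, i] \<longleftrightarrow>
     a = Some p \<and> (b = Some p \<and> c = Some p \<or> d = Some p \<and> g = Some p \<or> e = Some p \<and> i = Some p) \<or>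
     e = Some p \<and> (b = Some p \<and> h = Some p \<or> d = Some p \<and> f = Some p \<or> c = Some p \<and> g = Some p) \<or>
     i = Some p \<and> (c = Some p \<and> f = Some p \<or> g = Some p \<and> h = Some p)"
| "line p _ = False"

text \<open>Bob has a mark in each of the eight lines, so Alice can no longer win even if play
  continues.\<close>

fun blocked :: "player option list \<Rightarrow> bool" where
  "blocked [a, b, c, d, e, f, g, h, i] \<longleftrightarrow>
     (a = Some Bob \<or> b = Some Bob \<or> c = Some Bob) \<and>
     (d = Some Bob \<or> e = Some Bob \<or> f = Some Bob) \<and>
     (g = Some Bob \<or> h = Some Bob \<or> i = Some Bob) \<and>
     (a = Some Bob \<or> d = Some Bob \<or> g = Some Bob) \<and>
     (b = Some Bob \<or> e = Some Bob \<or> h = Some Bob) \<and>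
     (c = Some Bob \<or> f = Some Bob \<or> i = Some Bob) \<and>
     (a = Some Bob \<or> e = Some Bob \<or> i = Some Bob) \<and>
     (c = Some Bob \<or> e = Some Bob \<or> g = Some Bob)"
| "blocked _ = False"

fun mirror :: "player option list \<Rightarrow> player option list" where
  "mirror [a, b, c, d, e, f, g, h, i] = [c, b, a, f, e, d, i, h, g]"
| "mirror xs = xs"

fun transpose9 :: "player option list \<Rightarrow> player option list" where
  "transpose9 [a, b, c, d, e, f, g, h, i] = [a, d, g, b, e, h, c, f, i]"
| "transpose9 xs = xs"

primrec moves :: "player \<Rightarrow> player option list \<Rightarrow> player option list list" where
  "moves p [] = []"
| "moves p (c # cs) = (if c = None then [Some p # cs] else []) @ map ((#) c) (moves p cs)"

text \<open>Mirroring followed by transposing is a quarter turn. Four turns, each with its mirror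
  image, give all eight symmetries of the square.\<close>

primrec images :: "nat \<Rightarrow> player option list \<Rightarrow> player option list list" where
  "images 0 xs = []"
| "images (Suc n) xs = xs # mirror xs # images n (transpose9 (mirror xs))"

primrec search :: "trie \<Rightarrow> player option list list \<Rightarrow> nat \<Rightarrow> nat" where
  "search t [] d = d"
| "search t (xs # xss) d = (case look t xs of None \<Rightarrow> search t xss d | Some i \<Rightarrow> i)"

text \<open>The defaults make positions missing from a table harmless: index 1 stands for the
  trivial upper bound \<open>2 * K\<close>, and in \<open>lower\<close> index 0 stands for the
  trivial lower bound.\<close>

definition upper :: "player option list \<Rightarrow> nat" where
  "upper xs = (if line Alice xs then 0 else search upper_table (images 4 xs) 1)"

definition lower :: "player option list \<Rightarrow> nat" where
  "lower xs =
     (if line Alice xs then 0 else if line Bob xs then 1 else if blocked xs then 1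
      else search lower_table (images 4 xs) 0)"

text \<open>A local condition on one leaf: one good move of Alice, but all moves of Bob. The good
  move also shows that the board is not full. The test for index 1 skips Bob's moves where the bound
  on them is trivial.\<close>

definition upper_ok :: "player option list \<Rightarrow> nat \<Rightarrow> bool" where
  "upper_ok xs i \<longleftrightarrow>
     1 < i \<and> i < 48 \<and> \<not> line Bob xs \<and>
     list_ex (\<lambda>ys. le (upper ys) (fst (gen i))) (moves Alice xs) \<and>
     (if snd (gen i) = 1 then True else list_all (\<lambda>ys. le (upper ys) (snd (gen i))) (moves Bob xs))"

definition lower_ok :: "player option list \<Rightarrow> nat \<Rightarrow> bool" where
  "lower_ok xs i \<longleftrightarrow>
     1 < i \<and> i < 48 \<and> \<not> line Alice xs \<and>
     list_ex (\<lambda>ys. le (snd (gen i)) (lower ys)) (moves Bob xs) \<and>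
     (if fst (gen i) = 0 then True else list_all (\<lambda>ys. le (fst (gen i)) (lower ys)) (moves Alice xs))"

text \<open>With these congruence rules the simplifier does not descend into the tables.\<close>

lemma look_cong: "xs = ys \<Longrightarrow> look t xs = look t ys" by simp
lemma every_cong: "xs = ys \<Longrightarrow> every P t xs = every P t ys" by simp

text \<open>Through this detour the table is unfolded only below \<open>look\<close>, where it is
  protected from rewriting.\<close>

lemma look_upper: "look upper_table xs = look t xs" if "t = upper_table"
  by (simp add: that)

lemmas look_upper_table = look_upper[OF upper_table_def[symmetric]]

lemma look_lower: "look lower_table xs = look t xs" if "t = lower_table"
  by (simp add: that)

lemmas look_lower_table = look_lower[OF lower_table_def[symmetric]]

text \<open>Stated for nine explicit cells, so that \<open>upper\<close> is unfolded only where the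
  lookup can be evaluated.\<close>

lemma upper_cells:
  "upper [a, b, c, d, e, f, g, h, i] =
    (if line Alice [a, b, c, d, e, f, g, h, i] then 0
     else search upper_table (images 4 [a, b, c, d, e, f, g, h, i]) 1)"
  unfolding upper_def ..

lemma lower_cells:
  "lower [a, b, c, d, e, f, g, h, i] =
    (if line Alice [a, b, c, d, e, f, g, h, i] then 0
     else if line Bob [a, b, c, d, e, f, g, h, i] then 1
     else if blocked [a, b, c, d, e, f, g, h, i] then 1
     else search lower_table (images 4 [a, b, c, d, e, f, g, h, i]) 0)"
  unfolding lower_def ..

lemma images_4: "images 4 xs = images (Suc (Suc (Suc (Suc 0)))) xs"
  by (simp add: eval_nat_numeral)

lemmas table_simps = images_4 look_upper_table look_lower_table upper_cells lower_cells le_facts gen_eqs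

lemma upper_table_ok: "every upper_ok upper_table []"
  by (subst upper_table_def) (simp add: table_simps upper_ok_def cong: look_cong every_cong)

lemma lower_table_ok: "every lower_ok lower_table []"
  by (subst lower_table_def) (simp add: table_simps lower_ok_def cong: look_cong every_cong)

definition board_of :: "player option list \<Rightarrow> board" where
  "board_of xs q = (if q \<in> squares then xs ! (3 * fst q + snd q) else None)"

lemma lines_eq:
  "lines = (\<lambda>i. {(i, 0), (i, 1), (i, 2)}) ` {0, 1, 2} \<union> (\<lambda>j. {(0, j), (1, j), (2, j)}) ` {0, 1, 2}
    \<union> {{(0, 0), (1, 1), (2, 2)}, {(0, 2), (1, 1), (2, 0)}}"
proof -
  have rows: "{i} \<times> {0, 1, 2} = {(i, 0), (i, 1), (i, 2)}"
    and columns: "{0, 1, 2} \<times> {i} = {(0, i), (1, i), (2, i)}" for i :: nat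
    by auto
  show ?thesis
    unfolding lines_def rows columns Setcompr_eq_image Collect_mem_eq by (rule refl)
qed

lemma has_line_eq:
  "has_line B p \<longleftrightarrow>
     B (0, 0) = Some p \<and> B (0, 1) = Some p \<and> B (0, 2) = Some p \<or>
     B (1, 0) = Some p \<and> B (1, 1) = Some p \<and> B (1, 2) = Some p \<or>
     B (2, 0) = Some p \<and> B (2, 1) = Some p \<and> B (2, 2) = Some p \<or>
     B (0, 0) = Some p \<and> B (1, 0) = Some p \<and> B (2, 0) = Some p \<or>
     B (0, 1) = Some p \<and> B (1, 1) = Some p \<and> B (2, 1) = Some p \<or>
     B (0, 2) = Some p \<and> B (1, 2) = Some p \<and> B (2, 2) = Some p \<or>
     B (0, 0) = Some p \<and> B (1, 1) = Some p \<and> B (2, 2) = Some p \<or>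
     B (0, 2) = Some p \<and> B (1, 1) = Some p \<and> B (2, 0) = Some p"
  unfolding has_line_def lines_eq by (simp add: disj_ac)

definition dead :: "board \<Rightarrow> bool" where
  "dead B \<longleftrightarrow> (\<forall>l\<in>lines. \<exists>q\<in>l. B q = Some Bob)"

lemma dead_eq:
  "dead B \<longleftrightarrow>
     (B (0, 0) = Some Bob \<or> B (0, 1) = Some Bob \<or> B (0, 2) = Some Bob) \<and>
     (B (1, 0) = Some Bob \<or> B (1, 1) = Some Bob \<or> B (1, 2) = Some Bob) \<and>
     (B (2, 0) = Some Bob \<or> B (2, 1) = Some Bob \<or> B (2, 2) = Some Bob) \<and>
     (B (0, 0) = Some Bob \<or> B (1, 0) = Some Bob \<or> B (2, 0) = Some Bob) \<and>
     (B (0, 1) = Some Bob \<or> B (1, 1) = Some Bob \<or> B (2, 1) = Some Bob) \<and>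
     (B (0, 2) = Some Bob \<or> B (1, 2) = Some Bob \<or> B (2, 2) = Some Bob) \<and>
     (B (0, 0) = Some Bob \<or> B (1, 1) = Some Bob \<or> B (2, 2) = Some Bob) \<and>
     (B (0, 2) = Some Bob \<or> B (1, 1) = Some Bob \<or> B (2, 0) = Some Bob)"
  unfolding dead_def lines_eq by (simp add: conj_ac)

text \<open>Marks are never removed, so a blocked board stays blocked until the game ends without a
  line of Alice.\<close>

lemma val_dead: "dead B \<Longrightarrow> val K B = 2 * K"
proof (induction K B rule: val.induct)
  case (1 K B)
  have noA: "\<not> has_line B Alice"
    using "1.prems" by (fastforce simp: dead_def has_line_def)
  show ?case
  proof (cases "game_over B")
    case True
    then show ?thesis using noA by (simp add: val_Bob)
  next
    case False
    then have ne: "\<not> has_line B Bob" "squares \<inter> empties B \<noteq> {}" "empties B \<noteq> {}"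
      by (auto simp: game_over_iff)
    have dead: "dead (place p B q)" if "q \<in> empties B" for p q
    proof (unfold dead_def, intro ballI)
      fix l
      assume "l \<in> lines"
      then obtain r where "r \<in> l" "B r = Some Bob" using "1.prems" unfolding dead_def by blast
      then show "\<exists>r\<in>l. place p B q r = Some Bob"
        using that by (intro bexI[of _ r]) (auto simp: place_def empties_def)
    qed
    obtain q where q: "q \<in> squares \<inter> empties B" "val K (place Alice B q) = lo K squares B"
      by (rule lo_attained[OF ne(2)])
    obtain q' where q': "q' \<in> empties B" "val K (place Bob B q') = hi K B"
      by (rule hi_attained[OF ne(3)])
    have "val K (place Alice B q) = 2 * K"
      using "1.IH"(1)[OF noA _ _ dead] q(1) ne by simp
    moreover have "val K (place Bob B q') = 2 * K"
      using "1.IH"(2)[OF noA _ _ dead] q'(1) ne by simp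
    ultimately have "lo K squares B = 2 * K" "hi K B = 2 * K"
      using q(2) q'(2) by simp_all
    then show ?thesis using False by (simp add: val_running mean_def)
  qed
qed

section \<open>Symmetries of the board\<close>

locale board_symmetry =
  fixes g :: "square \<Rightarrow> square"
  assumes involution: "g (g q) = q"
    and squares_iff: "g q \<in> squares \<longleftrightarrow> q \<in> squares"
    and has_line_comp: "has_line (B \<circ> g) p = has_line B p"
begin

lemma empties_comp: "empties (B \<circ> g) = g ` empties B"
proof -
  have "q \<in> g ` empties B" if "g q \<in> empties B" for q
    using that involution by (metis imageI)
  then show ?thesis
    by (auto simp: empties_def squares_iff involution)
qed

lemma card_empties_comp: "card (empties (B \<circ> g)) = card (empties B)"
  unfolding empties_comp by (rule card_image) (metis inj_onI involution)

lemma place_comp: "place p (B \<circ> g) (g q) = place p B q \<circ> g"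
  by (rule ext) (use involution in \<open>auto simp: place_def\<close>)

lemma val_comp: "val K (B \<circ> g) = val K B"
proof (induction K B rule: val.induct)
  case (1 K B)
  show ?case
  proof (cases "has_line B Alice \<or> has_line B Bob \<or> empties B = {}")
    case True
    then show ?thesis
      by (subst (1 2) val.simps) (auto simp: has_line_comp empties_comp)
  next
    case False
    have IH: "val K (place p B q \<circ> g) = val K (place p B q)" if "q \<in> empties B" for p q
      using "1.IH"(1)[OF _ _ that] "1.IH"(2)[OF _ _ that] False by (cases p) (simp_all add: comp_def)
    have "(\<lambda>q. val K (place p (B \<circ> g) q)) ` empties (B \<circ> g) = (\<lambda>q. val K (place p B q)) ` empties B" for p
    proof -
      have "(\<lambda>q. val K (place p (B \<circ> g) q)) ` empties (B \<circ> g)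
          = (\<lambda>q. val K (place p B q \<circ> g)) ` empties B"
        by (simp add: empties_comp image_image place_comp)
      also have "\<dots> = (\<lambda>q. val K (place p B q)) ` empties B"
        using IH by (rule image_cong[OF refl])
      finally show ?thesis .
    qed
    with False show ?thesis
      by (subst (1 2) val.simps) (simp add: has_line_comp empties_comp)
  qed
qed

end

interpretation swap: board_symmetry prod.swap
proof
  show "prod.swap q \<in> squares \<longleftrightarrow> q \<in> squares" for q :: square
    by (cases q) (auto simp: squares_def)
  show "has_line (B \<circ> prod.swap) p = has_line B p" for B p
    unfolding has_line_eq by auto
qed simp

text \<open>Off the board \<open>2 - snd q\<close> would truncate and fail to be an involution,
  hence the identity there.\<close>

definition reflect :: "square \<Rightarrow> square" where
  "reflect q = (if q \<in> squares then (fst q, 2 - snd q) else q)"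

interpretation reflect: board_symmetry reflect
proof
  show "reflect (reflect q) = q" for q
    by (cases q) (auto simp: reflect_def squares_def)
  show "reflect q \<in> squares \<longleftrightarrow> q \<in> squares" for q
    by (cases q) (auto simp: reflect_def squares_def)
  show "has_line (B \<circ> reflect) p = has_line B p" for B p
    unfolding has_line_eq by (auto simp: reflect_def squares_def)
qed

lemma length_9E:
  assumes "length xs = 9"
  obtains a b c d e f g h i where "xs = [a, b, c, d, e, f, g, h, i]"
proof -
  obtain a b c d e f g h i where "xs = [a, b, c, d, e, f, g, h, i]"
    using assms by (clarsimp simp: numeral_eq_Suc length_Suc_conv)
  then show thesis by (rule that)
qed

lemma has_line_board_of: "length xs = 9 \<Longrightarrow> has_line (board_of xs) p \<longleftrightarrow> line p xs"
  by (erule length_9E, simp add: has_line_eq board_of_def squares_def, rule iffI; elim disjE conjE; simp)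

lemma dead_board_of: "length xs = 9 \<Longrightarrow> blocked xs \<Longrightarrow> dead (board_of xs)"
  by (erule length_9E) (simp add: dead_eq board_of_def squares_def)

lemma board_of_mirror: "length xs = 9 \<Longrightarrow> board_of (mirror xs) = board_of xs \<circ> reflect"
  by (erule length_9E) (auto simp: board_of_def squares_def reflect_def fun_eq_iff)

lemma board_of_transpose9:
  assumes "length xs = 9"
  shows "board_of (transpose9 xs) = board_of xs \<circ> prod.swap"
proof
  fix q
  from assms obtain a b c d e f g h i where "xs = [a, b, c, d, e, f, g, h, i]"
    by (rule length_9E)
  then show "board_of (transpose9 xs) q = (board_of xs \<circ> prod.swap) q"
    by (cases q) (auto simp: board_of_def squares_def)
qed

lemma length_mirror [simp]: "length (mirror xs) = length xs"
  by (induction xs rule: mirror.induct) auto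

lemma length_transpose9 [simp]: "length (transpose9 xs) = length xs"
  by (induction xs rule: transpose9.induct) auto

lemma mirror_invariant:
  assumes "length xs = 9"
  shows "val K (board_of (mirror xs)) = val K (board_of xs)"
    and "card (empties (board_of (mirror xs))) = card (empties (board_of xs))"
  unfolding board_of_mirror[OF assms] by (rule reflect.val_comp reflect.card_empties_comp)+

lemma transpose9_invariant:
  assumes "length xs = 9"
  shows "val K (board_of (transpose9 xs)) = val K (board_of xs)"
    and "card (empties (board_of (transpose9 xs))) = card (empties (board_of xs))"
  unfolding board_of_transpose9[OF assms] by (rule swap.val_comp swap.card_empties_comp)+

text \<open>The number of empty squares is included because the soundness proofs do induction on it
  and continue with the image found in the table.\<close>

lemma images_invariant:
  assumes "length xs = 9" "ys \<in> set (images n xs)"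
  shows "length ys = 9 \<and> val K (board_of ys) = val K (board_of xs) \<and>
    card (empties (board_of ys)) = card (empties (board_of xs))"
  using assms
proof (induction n arbitrary: xs)
  case (Suc n)
  have "length (transpose9 (mirror xs)) = 9" using Suc.prems by simp
  note IH = Suc.IH[OF this]
  show ?case
    using Suc.prems IH by (auto simp: mirror_invariant transpose9_invariant)
qed simp

lemma set_moves: "set (moves p xs) = {xs[i := Some p] |i. i < length xs \<and> xs ! i = None}"
proof (induction xs)
  case (Cons c cs)
  have "{(c # cs)[i := Some p] |i. i < length (c # cs) \<and> (c # cs) ! i = None} =
    {Some p # cs |_::unit. c = None} \<union> (#) c ` {cs[i := Some p] |i. i < length cs \<and> cs ! i = None}"
    (is "?L = ?R")
  proof
    show "?L \<subseteq> ?R"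
    proof
      fix ys assume "ys \<in> ?L"
      then obtain i where "ys = (c # cs)[i := Some p]" "i < length (c # cs)" "(c # cs) ! i = None"
        by auto
      then show "ys \<in> ?R" by (cases i) auto
    qed
    show "?R \<subseteq> ?L"
      by (force intro: exI[of _ 0] exI[of _ "Suc _"])
  qed
  with Cons.IH show ?case by auto
qed simp

lemma squares_eq: "squares = (\<lambda>i. (i div 3, i mod 3)) ` {..<9}"
proof -
  have "{..<9} = {0, 1, 2, 3, 4, 5, 6, 7, 8 :: nat}" by auto
  then show ?thesis by (auto simp: squares_def)
qed

lemma board_of_nth: "i < 9 \<Longrightarrow> board_of xs (i div 3, i mod 3) = xs ! i"
  by (simp add: board_of_def squares_eq)

lemma board_of_update:
  assumes "length xs = 9" "i < 9"
  shows "board_of (xs[i := Some p]) = place p (board_of xs) (i div 3, i mod 3)"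
proof
  fix q
  show "board_of (xs[i := Some p]) q = place p (board_of xs) (i div 3, i mod 3) q"
  proof (cases "q \<in> squares")
    case True
    then obtain j where j: "j < 9" "q = (j div 3, j mod 3)" by (auto simp: squares_eq)
    have "j = i" if "j div 3 = i div 3" "j mod 3 = i mod 3"
      using that by (metis mult_div_mod_eq)
    then show ?thesis
      using j assms by (auto simp: board_of_nth place_def nth_list_update)
  next
    case False
    moreover have "(i div 3, i mod 3) \<in> squares" using assms by (simp add: squares_eq)
    ultimately show ?thesis by (auto simp: board_of_def place_def)
  qed
qed

lemma moves_board_of:
  assumes "length xs = 9"
  shows "board_of ` set (moves p xs) = place p (board_of xs) ` empties (board_of xs)"
    and "ys \<in> set (moves p xs) \<Longrightarrow> length ys = 9"
proof -
  have E: "empties (board_of xs) = (\<lambda>i. (i div 3, i mod 3)) ` {i. i < 9 \<and> xs ! i = None}"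
    unfolding empties_def squares_eq using board_of_nth[of _ xs] by (auto intro: image_eqI)
  have upd: "board_of (xs[i := Some p]) = place p (board_of xs) (i div 3, i mod 3)" if "i < 9" for i
    using assms that by (rule board_of_update)
  have "set (moves p xs) = (\<lambda>i. xs[i := Some p]) ` {i. i < 9 \<and> xs ! i = None}"
    using assms by (auto simp: set_moves)
  then show "board_of ` set (moves p xs) = place p (board_of xs) ` empties (board_of xs)"
    by (simp add: E image_image upd cong: image_cong_simp)
  show "ys \<in> set (moves p xs) \<Longrightarrow> length ys = 9"
    using assms by (auto simp: set_moves)
qed

section \<open>Soundness of the tables\<close>

lemma search_cases:
  "search t xss d = d \<or> (\<exists>xs\<in>set xss. look t xs = Some (search t xss d))"
  by (induction xss) (auto split: option.splits)

text \<open>The leaf found belongs to a symmetric copy \<open>ys\<close>, whose value is the same.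
  One good move of Alice bounds \<open>lo\<close>, all moves of Bob bound \<open>hi\<close>, and the
  generating pair combines the two.\<close>

lemma val_upper: "length xs = 9 \<Longrightarrow> val K (board_of xs) \<le> bound K (upper xs)"
proof (induction "card (empties (board_of xs))" arbitrary: xs rule: less_induct)
  case less
  show ?case
  proof (cases "line Alice xs \<or> upper xs = 1")
    case True
    then show ?thesis
    proof
      assume "line Alice xs"
      then show ?thesis using less.prems by (simp add: val_Alice has_line_board_of)
    next
      assume "upper xs = 1"
      then show ?thesis using val_le by simp
    qed
  next
    case False
    define i where "i = upper xs"
    obtain ys where ys: "ys \<in> set (images 4 xs)" "look upper_table ys = Some i"
      using False search_cases[of upper_table "images 4 xs" 1] by (auto simp: upper_def i_def)
    then have ok: "upper_ok ys i"
      using every_look[OF upper_table_ok] by simp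
    from images_invariant[OF less.prems ys(1), of K]
    have inv: "length ys = 9" "val K (board_of ys) = val K (board_of xs)"
      "card (empties (board_of ys)) = card (empties (board_of xs))" by auto
    have noBob: "\<not> has_line (board_of ys) Bob"
      using ok inv by (simp add: upper_ok_def has_line_board_of)
    have IH: "val K (board_of zs) \<le> bound K (upper zs)" if "zs \<in> set (moves p ys)" for p zs
    proof -
      from that have "board_of zs \<in> place p (board_of ys) ` empties (board_of ys)"
        using moves_board_of(1)[OF inv(1), of p] by blast
      then have "card (empties (board_of zs)) < card (empties (board_of ys))" by auto
      then show ?thesis
        using less.hyps[of zs] moves_board_of(2)[OF inv(1) that] inv(3) by simp
    qed
    obtain zs where zs: "zs \<in> set (moves Alice ys)" "le (upper zs) (fst (gen i))"
      using ok by (auto simp: upper_ok_def list_ex_iff)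
    obtain q where q: "q \<in> empties (board_of ys)" "board_of zs = place Alice (board_of ys) q"
      using zs moves_board_of(1)[OF inv(1), of Alice] by blast
    show ?thesis
    proof (cases "has_line (board_of ys) Alice")
      case True
      then show ?thesis using inv by (simp add: val_Alice)
    next
      case running: False
      then have over: "\<not> game_over (board_of ys)" using noBob q by (auto simp: game_over_iff)
      have "lo K squares (board_of ys) \<le> bound K (upper zs)"
        using lo_le[of q squares "board_of ys" K] q IH[OF zs(1)] by simp
      then have lo: "lo K squares (board_of ys) \<le> bound K (fst (gen i))"
        using zs(2) by (auto simp: le_def intro: order_trans)
      have ne: "empties (board_of ys) \<noteq> {}" using q(1) by blast
      obtain q' where q': "q' \<in> empties (board_of ys)"
          "val K (place Bob (board_of ys) q') = hi K (board_of ys)"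
        by (rule hi_attained[OF ne])
      have "place Bob (board_of ys) q' \<in> board_of ` set (moves Bob ys)"
        unfolding moves_board_of(1)[OF inv(1)] using q'(1) by (rule imageI)
      then obtain ws where ws: "ws \<in> set (moves Bob ys)" "board_of ws = place Bob (board_of ys) q'"
        by (metis imageE)
      have "hi K (board_of ys) \<le> bound K (snd (gen i))"
      proof (cases "snd (gen i) = 1")
        case True
        then show ?thesis using val_le[of K] q'(2) by (metis One_nat_def bound_1)
      next
        case False
        then have "le (upper ws) (snd (gen i))"
          using ok ws by (auto simp: upper_ok_def list_all_iff)
        then show ?thesis
          using IH[OF ws(1)] ws(2) q'(2) by (auto simp: le_def intro: order_trans)
      qed
      with lo have "val K (board_of ys) \<le> bound K i"
        using gen_bound[of i K] ok over by (simp add: upper_ok_def val_running mean_mono)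
      then show ?thesis using inv by (simp add: i_def)
    qed
  qed
qed

text \<open>The dual argument: one good move of Bob bounds \<open>hi\<close> from below, all moves
  of Alice bound \<open>lo\<close>.\<close>

lemma val_lower: "length xs = 9 \<Longrightarrow> bound K (lower xs) \<le> val K (board_of xs)"
proof (induction "card (empties (board_of xs))" arbitrary: xs rule: less_induct)
  case less
  show ?case
  proof (cases "lower xs = 0 \<or> \<not> line Alice xs \<and> (line Bob xs \<or> blocked xs)")
    case True
    then show ?thesis
    proof (elim disjE conjE)
      assume "\<not> line Alice xs" "line Bob xs"
      then show ?thesis
        using less.prems by (simp add: lower_def val_Bob has_line_board_of game_over_iff)
    next
      assume "\<not> line Alice xs" "blocked xs"
      then show ?thesis
        using less.prems by (simp add: lower_def val_dead dead_board_of)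
    qed simp
  next
    case False
    define i where "i = lower xs"
    obtain ys where ys: "ys \<in> set (images 4 xs)" "look lower_table ys = Some i"
      using False search_cases[of lower_table "images 4 xs" 0]
      by (auto simp: lower_def i_def split: if_splits)
    then have ok: "lower_ok ys i"
      using every_look[OF lower_table_ok] by simp
    from images_invariant[OF less.prems ys(1), of K]
    have inv: "length ys = 9" "val K (board_of ys) = val K (board_of xs)"
      "card (empties (board_of ys)) = card (empties (board_of xs))" by auto
    have noAlice: "\<not> has_line (board_of ys) Alice"
      using ok inv by (simp add: lower_ok_def has_line_board_of)
    have IH: "bound K (lower zs) \<le> val K (board_of zs)" if "zs \<in> set (moves p ys)" for p zs
    proof -
      from that have "board_of zs \<in> place p (board_of ys) ` empties (board_of ys)"
        using moves_board_of(1)[OF inv(1), of p] by blast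
      then have "card (empties (board_of zs)) < card (empties (board_of ys))" by auto
      then show ?thesis
        using less.hyps[of zs] moves_board_of(2)[OF inv(1) that] inv(3) by simp
    qed
    obtain zs where zs: "zs \<in> set (moves Bob ys)" "le (snd (gen i)) (lower zs)"
      using ok by (auto simp: lower_ok_def list_ex_iff)
    obtain q where q: "q \<in> empties (board_of ys)" "board_of zs = place Bob (board_of ys) q"
      using zs moves_board_of(1)[OF inv(1), of Bob] by blast
    have "bound K i \<le> val K (board_of ys)"
    proof (cases "game_over (board_of ys)")
      case True
      have "bound K i \<le> 2 * K"
        by (rule bound_le)
      then show ?thesis using True noAlice by (simp add: val_Bob)
    next
      case running: False
      have "bound K (lower zs) \<le> hi K (board_of ys)"
        using hi_ge[of q "board_of ys" K] q IH[OF zs(1)] by simp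
      then have hi: "bound K (snd (gen i)) \<le> hi K (board_of ys)"
        using zs(2) by (auto simp: le_def intro: order_trans)
      have ne: "squares \<inter> empties (board_of ys) \<noteq> {}" using q(1) by auto
      obtain q' where q': "q' \<in> empties (board_of ys)"
          "val K (place Alice (board_of ys) q') = lo K squares (board_of ys)"
        by (rule lo_attained[OF ne, of K]) simp
      have "place Alice (board_of ys) q' \<in> board_of ` set (moves Alice ys)"
        unfolding moves_board_of(1)[OF inv(1)] using q'(1) by (rule imageI)
      then obtain ws where ws: "ws \<in> set (moves Alice ys)" "board_of ws = place Alice (board_of ys) q'"
        by (metis imageE)
      have "bound K (fst (gen i)) \<le> lo K squares (board_of ys)"
      proof (cases "fst (gen i) = 0")
        case False
        then have "le (fst (gen i)) (lower ws)"
          using ok ws by (auto simp: lower_ok_def list_all_iff)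
        then show ?thesis
          using IH[OF ws(1)] ws(2) q'(2) by (auto simp: le_def intro: order_trans)
      qed simp
      with hi show ?thesis
        using gen_bound[of i K] ok running by (simp add: lower_ok_def val_running mean_mono)
    qed
    then show ?thesis using inv by (simp add: i_def)
  qed
qed

section \<open>First moves\<close>

definition count_of_rank :: "nat \<Rightarrow> chip_count" where
  "count_of_rank n = (if even n then Plain (n div 2) else Starred (n div 2))"

lemma rank_count_of_rank [simp]: "rank (count_of_rank n) = n"
  by (simp add: count_of_rank_def)

lemma is_threshold_count_of_rank:
  assumes "\<And>c. amount c \<le> k \<Longrightarrow> W c \<longleftrightarrow> n \<le> rank c" "n \<le> 2 * (k + 1)"
  shows "is_threshold k W (count_of_rank n)"
  using assms by (simp add: is_threshold_def less_eq_chip_count_def)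

definition opening_threshold :: "square set \<Rightarrow> nat \<Rightarrow> nat" where
  "opening_threshold S k = mean (lo (k + 1) S (\<lambda>q. None)) (hi (k + 1) (\<lambda>q. None))"

lemma empties_empty [simp]: "empties (\<lambda>q. None) = squares"
  by (simp add: empties_def)

lemma squares_nonempty: "squares \<noteq> {}"
  by (simp add: squares_def)

lemma empty_running: "\<not> game_over (\<lambda>q. None)"
  by (simp add: game_over_iff has_line_eq squares_nonempty)

lemma alice_wins_opening_iff:
  assumes "amount c \<le> k" "S \<inter> squares \<noteq> {}"
  shows "alice_wins_opening S k c \<longleftrightarrow> opening_threshold S k \<le> rank c"
proof -
  let ?s = "initial_state k c"
  have "total ?s = k" using assms(1) by (simp add: total_def initial_state_def)
  moreover have "board ?s = (\<lambda>q. None)" by (simp add: initial_state_def)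
  moreover have "state_rank ?s = rank c" by (cases c) (simp_all add: state_rank_def initial_state_def)
  ultimately show ?thesis
    using opening_iff[of ?s k S] assms(2) empty_running
    by (simp add: alice_wins_opening_def opening_threshold_def)
qed

text \<open>Legality already confines the first move to the board, so the unrestricted game is the
  opening with \<open>S = squares\<close>.\<close>

lemma alice_wins_eq_opening: "alice_wins k = alice_wins_opening squares k"
proof
  fix c
  have "choose_square \<sigma> [] b w \<in> squares" if "winning_strategy (initial_state k c) \<sigma>" for \<sigma> b w
    using that empty_running
    by (auto simp: winning_strategy_def legal_strategy_def legal_history_Nil state_after_Nil initial_state_def)
  then show "alice_wins k c = alice_wins_opening squares k c"
    by (auto simp: alice_wins_def alice_wins_opening_def)
qed

lemma lo_eqI:
  assumes "q \<in> S" "S \<subseteq> squares" "val K (place Alice (\<lambda>q. None) q) = m"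
    "\<And>q. q \<in> S \<Longrightarrow> m \<le> val K (place Alice (\<lambda>q. None) q)"
  shows "lo K S (\<lambda>q. None) = m"
proof -
  have "S \<inter> empties (\<lambda>q. None) = S" "finite S"
    using assms(2) finite_subset[OF assms(2)] by auto
  then show ?thesis
    unfolding lo_def using assms by (intro Min_eqI) auto
qed

lemma opening_threshold_le:
  assumes "S \<inter> squares \<noteq> {}"
  shows "opening_threshold S k \<le> 2 * (k + 1)"
proof -
  obtain q where "val (k + 1) (place Bob (\<lambda>q. None) q) = hi (k + 1) (\<lambda>q. None)"
    using hi_attained[of "\<lambda>q. None" "k + 1"] squares_nonempty by (metis empties_empty)
  then have "hi (k + 1) (\<lambda>q. None) \<le> 2 * (k + 1)"
    using val_le by metis
  moreover have "lo (k + 1) S (\<lambda>q. None) \<le> hi (k + 1) (\<lambda>q. None)"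
    using assms by (intro lo_le_hi) simp
  ultimately have "opening_threshold S k \<le> mean (2 * (k + 1)) (2 * (k + 1))"
    unfolding opening_threshold_def by (intro mean_mono) auto
  then show ?thesis by (simp add: mean_def)
qed

lemma f_TTT_opening_eq:
  assumes "S \<inter> squares \<noteq> {}"
  shows "f_TTT_opening S k = count_of_rank (opening_threshold S k)"
  unfolding f_TTT_opening_def
  using is_threshold_count_of_rank[OF alice_wins_opening_iff[OF _ assms] opening_threshold_le[OF assms]]
  by (intro the_equality is_threshold_unique)

lemma f_TTT_eq: "f_TTT k = count_of_rank (opening_threshold squares k)"
  using f_TTT_opening_eq[of squares k] squares_nonempty
  by (simp add: f_TTT_def f_TTT_opening_def alice_wins_eq_opening)

definition half :: "nat \<Rightarrow> nat" where
  "half x = (x + 1) div 2"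

lemma half_mono: "x \<le> y \<Longrightarrow> half x \<le> half y"
  by (simp add: half_def div_le_mono)

lemma half_min: "half (min x y) = min (half x) (half y)"
  using half_mono[of x y] half_mono[of y x] by (auto simp: min_def)

text \<open>The summand from Bob's best move is common to both thresholds and cancels.\<close>

lemma optimal_iff:
  assumes "S \<inter> squares \<noteq> {}"
  shows "optimal_first_move S k \<longleftrightarrow>
    half (lo (k + 1) S (\<lambda>q. None)) = half (lo (k + 1) squares (\<lambda>q. None))"
proof -
  have "optimal_first_move S k \<longleftrightarrow> opening_threshold S k = opening_threshold squares k"
    unfolding optimal_first_move_def f_TTT_opening_eq[OF assms] f_TTT_eq
    by (metis rank_count_of_rank)
  then show ?thesis by (simp add: opening_threshold_def mean_def half_def)
qed

abbreviation center_board :: "player option list" where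
  "center_board \<equiv> [None, None, None, None, Some Alice, None, None, None, None]"
abbreviation corner_board :: "player option list" where
  "corner_board \<equiv> [Some Alice, None, None, None, None, None, None, None, None]"
abbreviation edge_board :: "player option list" where
  "edge_board \<equiv> [None, Some Alice, None, None, None, None, None, None, None]"

lemma board_of_singleton:
  assumes "i < 9"
  shows "board_of ((replicate 9 None)[i := Some p]) = place p (\<lambda>q. None) (i div 3, i mod 3)"
proof -
  have "board_of (replicate 9 None) = (\<lambda>q. None)"
    by (auto simp: board_of_def squares_def)
  then show ?thesis using board_of_update[of "replicate 9 None" i p] assms by simp
qed

lemma first_moves:
  "val K (place Alice (\<lambda>q. None) center) = val K (board_of center_board)"
  "q \<in> corners \<Longrightarrow> val K (place Alice (\<lambda>q. None) q) = val K (board_of corner_board)"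
  "q \<in> {(0, 1), (1, 0), (1, 2), (2, 1)} \<Longrightarrow>
     val K (place Alice (\<lambda>q. None) q) = val K (board_of edge_board)"
proof -
  define v where "v i = val K (board_of ((replicate 9 None)[i := Some Alice]))" for i
  have v: "val K (place Alice (\<lambda>q. None) (i div 3, i mod 3)) = v i" if "i < 9" for i
    using that by (simp add: v_def board_of_singleton)
  have lists: "v 0 = val K (board_of corner_board)" "v 1 = val K (board_of edge_board)"
      "v 4 = val K (board_of center_board)"
    by (simp_all add: v_def eval_nat_numeral)
  \<comment> \<open>Mirroring and transposing link the corners in the chain 0, 2, 6, 8 and the edges
    in the chain 1, 3, 5, 7.\<close>
  have mirror: "v 2 = v 0" "v 8 = v 6" "v 5 = v 3"
    using mirror_invariant(1)[of "(replicate 9 None)[0 := Some Alice]" K]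
      mirror_invariant(1)[of "(replicate 9 None)[6 := Some Alice]" K]
      mirror_invariant(1)[of "(replicate 9 None)[3 := Some Alice]" K]
    by (simp_all add: v_def eval_nat_numeral)
  have transpose: "v 6 = v 2" "v 3 = v 1" "v 7 = v 5"
    using transpose9_invariant(1)[of "(replicate 9 None)[2 := Some Alice]" K]
      transpose9_invariant(1)[of "(replicate 9 None)[1 := Some Alice]" K]
      transpose9_invariant(1)[of "(replicate 9 None)[5 := Some Alice]" K]
    by (simp_all add: v_def eval_nat_numeral)
  show "val K (place Alice (\<lambda>q. None) center) = val K (board_of center_board)"
    using v[of 4] lists by (simp add: center_def)
  show "q \<in> corners \<Longrightarrow> val K (place Alice (\<lambda>q. None) q) = val K (board_of corner_board)"
    using v[of 0] v[of 2] v[of 6] v[of 8] lists mirror transpose by (auto simp: corners_def)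
  show "q \<in> {(0, 1), (1, 0), (1, 2), (2, 1)} \<Longrightarrow>
     val K (place Alice (\<lambda>q. None) q) = val K (board_of edge_board)"
    using v[of 1] v[of 3] v[of 5] v[of 7] lists mirror transpose by auto
qed

text \<open>Both tables give the empty board with a center mark the same index, so its value is
  known exactly.\<close>

lemma center_val: "val K (board_of center_board) = bound K 45"
proof (rule antisym)
  have "upper center_board = 45" "lower center_board = 45"
    by (simp_all add: table_simps cong: look_cong)
  then show "val K (board_of center_board) \<le> bound K 45" "bound K 45 \<le> val K (board_of center_board)"
    using val_upper[of center_board K] val_lower[of center_board K] by simp_all
qed

lemma corner_val_le: "val K (board_of corner_board) \<le> bound K 44"
proof -
  have "upper corner_board = 44"
    by (simp add: table_simps cong: look_cong)
  then show ?thesis using val_upper[of corner_board K] by simp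
qed

text \<open>A lower bound suffices, since edges only have to be excluded as strictly better first
  moves.\<close>

lemma edge_val_ge: "bound K 47 \<le> val K (board_of edge_board)"
proof -
  have "lower edge_board = 47"
    by (simp add: table_simps cong: look_cong)
  then show ?thesis using val_lower[of edge_board K] by simp
qed

lemma mean_min: "mean (min x x') y = min (mean x y) (mean x' y)"
  using mean_mono[of x x' y y] mean_mono[of x' x y y] by (auto simp: min_def)

text \<open>After a corner, Alice's best second move depends on \<open>K\<close>, so that no single bound is a sharp lower
  bound.\<close>

lemma corner_val_ge: "min (bound K 44) (bound K 46) \<le> val K (board_of corner_board)"
proof -
  let ?B = "board_of corner_board"
  have ne: "empties ?B \<noteq> {}"
    using moves_board_of(1)[of corner_board Alice] by auto
  have run: "\<not> game_over ?B"
    using ne by (simp add: game_over_iff has_line_board_of)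
  have len: "length corner_board = 9" by simp
  \<comment> \<open>The pairs of the bounds 44 and 46 are (39, 33) and (40, 33). Both 39 and 40 grow
    by 30 per period, so only rounding separates them.\<close>
  have all: "list_all (\<lambda>ys. le 39 (lower ys) \<or> le 40 (lower ys)) (moves Alice corner_board)"
    by (simp add: table_simps cong: look_cong)
  obtain q where q: "q \<in> empties ?B" "val K (place Alice ?B q) = lo K squares ?B"
    using lo_attained[of squares ?B K] ne by auto
  have "place Alice ?B q \<in> board_of ` set (moves Alice corner_board)"
    unfolding moves_board_of(1)[OF len] using q(1) by (rule imageI)
  then obtain ys where ys: "place Alice ?B q = board_of ys" "ys \<in> set (moves Alice corner_board)"
    by (rule imageE)
  have "bound K (lower ys) \<le> lo K squares ?B"
    using val_lower[OF moves_board_of(2)[OF len ys(2)], of K] unfolding ys(1)[symmetric] q(2) .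
  moreover have "le 39 (lower ys) \<or> le 40 (lower ys)"
    using all ys(2) unfolding list_all_iff by (rule bspec)
  ultimately have lo: "min (bound K 39) (bound K 40) \<le> lo K squares ?B"
    unfolding le_def min_le_iff_disj by (meson order_trans)
  have "list_ex (\<lambda>ys. le 33 (lower ys)) (moves Bob corner_board)"
    by (simp add: table_simps cong: look_cong)
  then obtain zs where zs: "zs \<in> set (moves Bob corner_board)" "le 33 (lower zs)"
    unfolding list_ex_iff by (rule bexE)
  have "board_of zs \<in> place Bob ?B ` empties ?B"
    unfolding moves_board_of(1)[OF len, symmetric] using zs(1) by (rule imageI)
  then obtain q' where "board_of zs = place Bob ?B q'" "q' \<in> empties ?B"
    by (rule imageE)
  then have "val K (board_of zs) \<le> hi K ?B"
    by (simp only: hi_ge)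
  moreover have "bound K (lower zs) \<le> val K (board_of zs)"
    by (rule val_lower[OF moves_board_of(2)[OF len zs(1)]])
  ultimately have hi: "bound K 33 \<le> hi K ?B"
    using zs(2) unfolding le_def by (meson order_trans)
  have "min (bound K 44) (bound K 46) = mean (min (bound K 39) (bound K 40)) (bound K 33)"
    unfolding mean_min by (simp add: bound_eqs)
  also have "\<dots> \<le> val K ?B"
    unfolding val_running[OF run] using lo hi by (rule mean_mono)
  finally show ?thesis .
qed

section \<open>Comparison of the first moves for all totals\<close>

lemma list_all_upt: "list_all P [m..<n] \<longleftrightarrow> (\<forall>i. m \<le> i \<and> i < n \<longrightarrow> P i)"
  by (auto simp: list_all_iff)

lemma period_induct:
  fixes P :: "nat \<Rightarrow> bool"
  assumes base: "\<And>K. m \<le> K \<Longrightarrow> K < m + 64 \<Longrightarrow> P K" and step: "\<And>K. P K \<Longrightarrow> P (K + 64)"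
    and "m \<le> K"
  shows "P K"
  using \<open>m \<le> K\<close>
proof (induction K rule: less_induct)
  case (less K)
  show ?case
  proof (cases "K < m + 64")
    case False
    then have "P (K - 64 + 64)" using less by (intro step less.IH) auto
    then show ?thesis using False by simp
  qed (use base less.prems in blast)
qed

text \<open>The center gains steadily: after halving, one period adds 23 to its bound and at least
  25 to the others. This carries the inequalities from one period to the next.\<close>

lemma bound_steps:
  "bound (K + 64) 44 = bound K 44 + 50" "bound (K + 64) 45 = bound K 45 + 46"
  "bound (K + 64) 46 = bound K 46 + 50" "bound (K + 64) 47 = bound K 47 + 51"
  by (subst bound_period; simp add: bound_eqs mean_def)+

text \<open>Both 44 and 46 occur because the corner value is only known to be at least their
  minimum.\<close>

definition center_least :: "nat \<Rightarrow> bool" where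
  "center_least K \<longleftrightarrow> half (bound K 45) \<le> half (bound K 44) \<and> half (bound K 45) \<le> half (bound K 46) \<and>
     half (bound K 45) \<le> half (bound K 47)"

definition corner_greater :: "nat \<Rightarrow> bool" where
  "corner_greater K \<longleftrightarrow> half (bound K 45) < half (bound K 44) \<and> half (bound K 45) < half (bound K 46)"

lemma center_least: "K \<noteq> 6 \<Longrightarrow> center_least K"
proof -
  assume K: "K \<noteq> 6"
  \<comment> \<open>The block of 64 values begins at 7, so \<open>70 = 6 + 64\<close>, which cannot
    be reached from the excluded 6, is checked directly.\<close>
  have "list_all center_least [0..<6]" "list_all center_least [7..<71]"
    by (simp_all add: upt_rec center_least_def half_def bound_eqs mean_def)
  then have small: "center_least K" if "K < 71" "K \<noteq> 6" for K
    using that unfolding list_all_upt by (cases "K < 6") simp_all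
  have step: "center_least (K + 64)" if "center_least K" for K
    using that unfolding center_least_def half_def bound_steps by auto
  have "center_least K" if "7 \<le> K" for K
    by (rule period_induct[of 7 center_least, OF _ step that]) (use small in auto)
  with K small show ?thesis by (cases "K < 7") auto
qed

lemma corner_greater:
  "K \<noteq> 0 \<Longrightarrow> K - 1 \<notin> {0, 1, 2, 3, 4, 5, 6, 7, 9, 11, 12, 13, 14, 19, 20, 22, 26} \<Longrightarrow> corner_greater K"
proof -
  assume K: "K \<noteq> 0" "K - 1 \<notin> {0, 1, 2, 3, 4, 5, 6, 7, 9, 11, 12, 13, 14, 19, 20, 22, 26}"
  \<comment> \<open>The largest exception is \<open>k = 26\<close>, that is
    \<open>K = 27\<close>.\<close>
  have "list_all corner_greater [28..<92]"
    by (simp add: upt_rec corner_greater_def half_def bound_eqs mean_def)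
  then have mid: "corner_greater K" if "28 \<le> K" "K < 92" for K
    using that unfolding list_all_upt by simp
  have step: "corner_greater (K + 64)" if "corner_greater K" for K
    using that unfolding corner_greater_def half_def bound_steps by auto
  have large: "corner_greater K" if "28 \<le> K" for K
    by (rule period_induct[of 28 corner_greater, OF _ step that]) (use mid in auto)
  \<comment> \<open>These are the values of \<open>K\<close> below 28 that are positive and not
    exceptional.\<close>
  have "list_all corner_greater [9, 11, 16, 17, 18, 19, 22, 24, 25, 26]"
    by (simp add: corner_greater_def half_def bound_eqs mean_def)
  moreover have "K \<in> {9, 11, 16, 17, 18, 19, 22, 24, 25, 26}" if "K < 28"
    using that K by (simp; presburger)
  ultimately show ?thesis using large by (cases "K < 28") auto
qed

lemma corner_le:
  "k \<in> {0, 1, 2, 3, 4, 5, 6, 7, 9, 11, 12, 13, 14, 19, 20, 22, 26} \<Longrightarrow>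
    half (bound (k + 1) 44) \<le> half (bound (k + 1) 45)"
  by (elim insertE emptyE) (simp_all add: half_def bound_eqs mean_def)

text \<open>At \<open>K = 6\<close> Bob's replies 32 and 33 are both worth 6, while rounding gives
  Alice's continuation 39 the value 2 against 3 for 40; so a corner beats the center.\<close>

lemma special_case: "half (bound 6 44) < half (bound 6 45)" "half (bound 6 44) \<le> half (bound 6 47)"
  by (simp_all add: half_def bound_eqs mean_def)

theorem theorem6p7:
  fixes k :: nat
  shows "(optimal_first_move {center} k \<longleftrightarrow> k \<noteq> 5) \<and>
         (optimal_first_move corners k \<longleftrightarrow>
            k \<in> {0, 1, 2, 3, 4, 5, 6, 7, 9, 11, 12, 13, 14, 19, 20, 22, 26})"
proof -
  define K c r e where "K = k + 1" and "c = val K (board_of center_board)"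
    and "r = val K (board_of corner_board)" and "e = val K (board_of edge_board)"
  have squares: "squares = insert center (corners \<union> {(0, 1), (1, 0), (1, 2), (2, 1)})"
    by (auto simp: squares_def center_def corners_def)
  have loc: "lo K {center} (\<lambda>q. None) = c"
    by (rule lo_eqI[of center]) (auto simp: squares first_moves(1) c_def)
  have corner: "(0, 0) \<in> corners" by (simp add: corners_def)
  have lor: "lo K corners (\<lambda>q. None) = r"
    by (rule lo_eqI[OF corner]) (auto simp: squares first_moves(2) corner r_def)
  have first: "val K (place Alice (\<lambda>q. None) q) \<in> {c, r, e}" if "q \<in> squares" for q
    using that first_moves(1)[of K] first_moves(2,3)[of q K]
    unfolding squares c_def r_def e_def by (elim insertE UnE) auto
  have los: "lo K squares (\<lambda>q. None) = min c (min r e)"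
  proof -
    have "val K (place Alice (\<lambda>q. None) center) = c" "val K (place Alice (\<lambda>q. None) (0, 0)) = r"
      "val K (place Alice (\<lambda>q. None) (0, 1)) = e"
      by (simp_all add: first_moves corners_def c_def r_def e_def)
    moreover have "center \<in> squares" "(0, 0) \<in> squares" "(0, 1) \<in> squares"
      by (simp_all add: squares_def center_def)
    ultimately have "\<exists>q\<in>squares. val K (place Alice (\<lambda>q. None) q) = min c (min r e)"
      by (metis min_def)
    then obtain q where q: "q \<in> squares" "val K (place Alice (\<lambda>q. None) q) = min c (min r e)"
      by blast
    show ?thesis
      by (rule lo_eqI[OF q(1) subset_refl q(2)]) (use first in fastforce)
  qed
  have "{center} \<inter> squares \<noteq> {}" "corners \<inter> squares \<noteq> {}"
    using corner by (auto simp: squares)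
  \<comment> \<open>As \<open>half\<close> distributes over \<open>min\<close>, optimality of a
    first move becomes a comparison of the halved values of center, corner and edge.\<close>
  note optimal = this[THEN optimal_iff, of k, folded K_def, unfolded loc lor los half_min]
  have center_iff: "optimal_first_move {center} k \<longleftrightarrow> half c \<le> half r \<and> half c \<le> half e"
    and corner_iff: "optimal_first_move corners k \<longleftrightarrow> half r \<le> half c \<and> half r \<le> half e"
    unfolding optimal by linarith+
  have c: "c = bound K 45" and r: "r \<le> bound K 44" "min (bound K 44) (bound K 46) \<le> r" and e: "bound K 47 \<le> e"
    using center_val corner_val_le corner_val_ge edge_val_ge by (simp_all add: c_def r_def e_def)
  have r_half: "half r \<le> half (bound K 44)" "half (bound K 44) \<le> half r \<or> half (bound K 46) \<le> half r"
    and e_half: "half (bound K 47) \<le> half e"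
    using half_mono[OF r(1)] half_mono[OF r(2)] half_mono[OF e] by (auto simp: half_min min_le_iff_disj)
  have least: "half c \<le> half r \<and> half c \<le> half e" if "k \<noteq> 5"
    using center_least[of K] that r_half e_half by (auto simp: center_least_def K_def c)
  have special: "half r < half c \<and> half r \<le> half e" if "k = 5"
    using special_case that r_half e_half by (simp add: K_def c)
  show ?thesis (is "_ \<and> (_ \<longleftrightarrow> k \<in> ?S)")
  proof
    show "optimal_first_move {center} k \<longleftrightarrow> k \<noteq> 5"
      using least special unfolding center_iff by (metis not_le)
    show "optimal_first_move corners k \<longleftrightarrow> k \<in> ?S"
    proof (cases "k \<in> ?S")
      case True
      have "half r \<le> half c" using corner_le[OF True] r_half by (simp add: K_def c)
      \<comment> \<open>Unless \<open>k = 5\<close>, the edge is compared through the center; for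
        \<open>k = 5\<close> the direct comparison is needed.\<close>
      then have "half r \<le> half e" using least special by (cases "k = 5") auto
      with \<open>half r \<le> half c\<close> True show ?thesis unfolding corner_iff by blast
    next
      case False
      have "corner_greater K" using False by (intro corner_greater) (simp_all add: K_def)
      then have "half c < half r" using r_half by (auto simp: corner_greater_def c)
      with False show ?thesis unfolding corner_iff by auto
    qed
  qed
qed

end
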